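(* Let $(\Omega,\theta,\mathbb{P})$ be a measurable dynamical system (a probability space with a measure-preserving map $\theta$), and let $A:\Omega\to\mathbb{R}_{\max}^{d\times d}$ be a random matrix with no line of $-\infty$, such that: 1. for every $i,j$, $A_{ij}$ is integrable or almost surely $-\infty$; 2. for every $k\in\{1,\dots,d\}$, $\theta^k$ is ergodic. Then the sequence $\left(\frac1n x(n,0)\right)_{n\in\mathbb{N}}$ associated to the sequence $(A(n))_{n\in\mathbb{N}}=(A\circ\theta^n)_{n\in\mathbb{N}}$ converges almost surely and its limit is given by $$\forall m\in\{1,\dots,K\},\quad \lim_n\frac1n x^{c_m}(n,0)=\gamma^{[m]}\mathbf{1}\quad\text{a.s.}$$
   Context: Max-plus conventions. $\mathbb{R}_{\max}=\mathbb{R}\cup\{-\infty\}$ is the semi-ring with addition $\max$ and multiplication $+$. Products are max-plus: $(Ax)_i=\max_j(A_{ij}+x_j)$, $(AB)_{ij}=\max_k(A_{ik}+B_{kj})$. $0$ denotes the vector with all coordinates $0$ and $\mathbf{1}$ the vector with all coordinates $1$; $\gamma\mathbf 1$ is the vector with all coordinates equal to $\gamma$. A random matrix has "no line of $-\infty$" if almost surely each of its rows contains an entry different from $-\infty$. Sequences. $x(n,0):=A(n-1)A(n-2)\cdots A(0)\,0$. For $I\subset\{1,\dots,d\}$ and a vector $x$, $x^I:=(x_i)_{i\in I}$. Maximal Lyapunov exponent. For a stationary ergodic sequence of (square) random matrices $(M(n))$ with entries in $\mathbb{R}_{\max}$ (rows of $-\infty$ allowed) with $\max_{ij}M^+_{ij}(0)$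 integrable, $\frac1n\max_{i,j}(M(n-1)\cdots M(0))_{ij}$ converges a.s. to a constant $\gamma(M)\in\mathbb{R}_{\max}$, the maximal Lyapunov exponent. Graph. $\mathcal{G}(A)$ is the directed graph with nodes $1,\dots,d$ and arcs the pairs $(i,j)$ with $\mathbb{P}(A_{ij}\neq-\infty)>0$. Its strongly connected components are $c_1,\dots,c_K$ (a component may be a single node without loop). Write $m\rightarrow l$ if $m=l$ or there is a path in $\mathcal{G}(A)$ from a node of $c_m$ to a node of $c_l$. For each $m$: $\gamma^{(m)}:=\gamma\big((A_{ij}(n))_{i,j\in c_m}\big)$; $E_m:=\{l: m\rightarrow l\}$; $\gamma^{[m]}:=\max_{l\in E_m}\gamma^{(l)}$. *)

theory Defs
  imports "HOL-Probability.Probability" "Graph_Theory.Digraph_Component"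
begin

section \<open>Max-plus matrix products\<close>

text \<open>
  The semiring of max-plus numbers is rendered by \<open>ereal\<close> without \<open>\<infinity>\<close>. The finite nonempty
  index set \<open>I\<close> of a matrix is explicit, so that the same definitions apply to the matrix
  itself (\<open>I = UNIV\<close>) and to its square submatrices with indices in \<open>I\<close>; only the entries with
  indices in \<open>I\<close> are used.
\<close>

definition mp_times ::
  "'i set \<Rightarrow> ('i \<Rightarrow> 'i \<Rightarrow> ereal) \<Rightarrow> ('i \<Rightarrow> 'i \<Rightarrow> ereal) \<Rightarrow> 'i \<Rightarrow> 'i \<Rightarrow> ereal" where
  "mp_times I A B = (\<lambda>i j. MAX k\<in>I. A i k + B k j)"

definition mp_apply :: "'i set \<Rightarrow> ('i \<Rightarrow> 'i \<Rightarrow> ereal) \<Rightarrow> ('i \<Rightarrow> ereal) \<Rightarrow> 'i \<Rightarrow> ereal" where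
  "mp_apply I A x = (\<lambda>i. MAX j\<in>I. A i j + x j)"

definition mp_one :: "'i \<Rightarrow> 'i \<Rightarrow> ereal" where
  "mp_one = (\<lambda>i j. if i = j then 0 else - \<infinity>)"

text \<open>\<open>mp_prod I M n\<close> is the product \<open>M (n-1) \<cdots> M 0\<close>, latest factor on the left.\<close>

primrec mp_prod :: "'i set \<Rightarrow> (nat \<Rightarrow> 'i \<Rightarrow> 'i \<Rightarrow> ereal) \<Rightarrow> nat \<Rightarrow> 'i \<Rightarrow> 'i \<Rightarrow> ereal" where
  "mp_prod I M 0 = mp_one"
| "mp_prod I M (Suc n) = mp_times I (M n) (mp_prod I M n)"

definition mp_orbit0 :: "(nat \<Rightarrow> 'i \<Rightarrow> 'i \<Rightarrow> ereal) \<Rightarrow> nat \<Rightarrow> 'i \<Rightarrow> ereal" where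
  "mp_orbit0 M n = mp_apply UNIV (mp_prod UNIV M n) (\<lambda>_. 0)"


section \<open>Dynamical systems and random matrices\<close>

definition measure_preserving_map :: "'w measure \<Rightarrow> ('w \<Rightarrow> 'w) \<Rightarrow> bool" where
  "measure_preserving_map P T \<longleftrightarrow> T \<in> measurable P P \<and> distr P P T = P"

definition ergodic_map :: "'w measure \<Rightarrow> ('w \<Rightarrow> 'w) \<Rightarrow> bool" where
  "ergodic_map P T \<longleftrightarrow> measure_preserving_map P T \<and>
     (\<forall>B\<in>sets P. T -` B \<inter> space P = B \<longrightarrow> measure P B = 0 \<or> measure P B = 1)"

definition random_mp_matrix :: "'w measure \<Rightarrow> ('w \<Rightarrow> 'i \<Rightarrow> 'i \<Rightarrow> ereal) \<Rightarrow> bool" where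
  "random_mp_matrix P A \<longleftrightarrow>
     (\<forall>i j. (\<lambda>\<omega>. A \<omega> i j) \<in> borel_measurable P \<and> (\<forall>\<omega>\<in>space P. A \<omega> i j \<noteq> \<infinity>))"

text \<open>Since \<open>\<bar>-\<infinity>\<bar> = \<infinity>\<close>, an integrable function is almost surely finite.\<close>

definition ereal_integrable :: "'w measure \<Rightarrow> ('w \<Rightarrow> ereal) \<Rightarrow> bool" where
  "ereal_integrable P f \<longleftrightarrow>
     f \<in> borel_measurable P \<and> (\<integral>\<^sup>+\<omega>. e2ennreal \<bar>f \<omega>\<bar> \<partial>P) < \<infinity>"

definition no_line_of_minf :: "'w measure \<Rightarrow> ('w \<Rightarrow> 'i \<Rightarrow> 'i \<Rightarrow> ereal) \<Rightarrow> bool" where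
  "no_line_of_minf P A \<longleftrightarrow> (AE \<omega> in P. \<forall>i. \<exists>j. A \<omega> i j \<noteq> - \<infinity>)"

text \<open>
  The almost sure constant limit of \<open>1/n max\<^sub>i\<^sub>j (M (n-1) \<cdots> M 0)\<^sub>i\<^sub>j\<close>, where \<open>M\<close> is a sequence of
  random matrices with indices in \<open>I\<close>. It can be \<open>-\<infinity>\<close>.
\<close>

definition max_lyapunov ::
  "'w measure \<Rightarrow> 'i set \<Rightarrow> (nat \<Rightarrow> 'w \<Rightarrow> 'i \<Rightarrow> 'i \<Rightarrow> ereal) \<Rightarrow> ereal" where
  "max_lyapunov P I M = (THE g. AE \<omega> in P.
     (\<lambda>n. ereal (1 / real n) * (MAX (i, j)\<in>I \<times> I. mp_prod I (\<lambda>k. M k \<omega>) n i j))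
       \<longlonglongrightarrow> g)"


section \<open>The graph of a random matrix and its components\<close>

definition mp_graph :: "'w measure \<Rightarrow> ('w \<Rightarrow> 'i \<Rightarrow> 'i \<Rightarrow> ereal) \<Rightarrow> ('i, 'i \<times> 'i) pre_digraph" where
  "mp_graph P A = \<lparr> verts = UNIV,
     arcs = {(i, j). measure P {\<omega>\<in>space P. A \<omega> i j \<noteq> - \<infinity>} > 0},
     tail = fst, head = snd \<rparr>"

text \<open>
  The strongly connected components, as sets of nodes. The library's reachability is reflexive,
  so a node without loop that lies on no cycle is a component of its own.
\<close>

abbreviation mp_components :: "'w measure \<Rightarrow> ('w \<Rightarrow> 'i \<Rightarrow> 'i \<Rightarrow> ereal) \<Rightarrow> 'i set set" where
  "mp_components P A \<equiv> pre_digraph.sccs_verts (mp_graph P A)"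

definition accessible_components ::
  "'w measure \<Rightarrow> ('w \<Rightarrow> 'i \<Rightarrow> 'i \<Rightarrow> ereal) \<Rightarrow> 'i set \<Rightarrow> 'i set set" where
  "accessible_components P A c =
     {c'\<in>mp_components P A. c = c' \<or> (\<exists>i\<in>c. \<exists>j\<in>c'. i \<rightarrow>\<^sup>*\<^bsub>mp_graph P A\<^esub> j)}"

text \<open>
  The exponent \<open>\<gamma>\<^sup>(\<^sup>m\<^sup>)\<close> of a component, and the maximum \<open>\<gamma>\<^sup>[\<^sup>m\<^sup>]\<close> of these exponents over the
  accessible components, for the sequence \<open>A \<circ> T\<^sup>n\<close>.
\<close>

definition component_exponent ::
  "'w measure \<Rightarrow> ('w \<Rightarrow> 'w) \<Rightarrow> ('w \<Rightarrow> 'i \<Rightarrow> 'i \<Rightarrow> ereal) \<Rightarrow> 'i set \<Rightarrow> ereal" where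
  "component_exponent P T A c = max_lyapunov P c (\<lambda>n \<omega>. A ((T ^^ n) \<omega>))"

definition accessible_exponent ::
  "'w measure \<Rightarrow> ('w \<Rightarrow> 'w) \<Rightarrow> ('w \<Rightarrow> 'i \<Rightarrow> 'i \<Rightarrow> ereal) \<Rightarrow> 'i set \<Rightarrow> ereal" where
  "accessible_exponent P T A c =
     (MAX c'\<in>accessible_components P A c. component_exponent P T A c')"

end

theory Submission
  imports Defs
begin

text \<open>
  Fix a strongly connected component with at least one arc, and let \<open>g\<close> be its period, so that
  \<open>\<theta>\<^sup>g\<close> is ergodic. Diagonal entries of the products of length \<open>g m\<close> are superadditive and
  integrable for large \<open>m\<close>; they all have the same mean growth rate, which bounds the growth of the
  component from below by Birkhoff's theorem for \<open>\<theta>\<^sup>g\<close>. Conversely, the maximum of the entries over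
  one cyclic class is subadditive, and closing a path to a loop changes its mean by a bounded
  amount only, so the same rate bounds the component from above. The integrability of all entries
  on arcs thus replaces Kingman's theorem by Birkhoff's. The upper bound even holds uniformly over
  all time windows, and it therefore passes from the components to the whole orbit by decomposing
  a path at its first exit from a component. The lower bound is obtained by following a fixed path
  to the best accessible component.
\<close>

section \<open>Birkhoff's ergodic theorem\<close>

text \<open>Between two fixed nodes of a component, an entry of a product is finite only for lengths
  in one residue class modulo the period \<open>g\<close>. Integrability and subadditivity therefore
  live on multiples of \<open>g\<close>, that is, on \<open>\<theta> ^^ g\<close>, and since the
  period is at most the number of nodes, ergodicity of these powers is what is asked. Bounding a
  subadditive sequence above by the mean of one long block needs only Birkhoff; the opposite bound
  is the hard one in Kingman's theorem. Here both bounds are of the first kind, one for minus a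
  diagonal entry and one for the maximum over a class, and they meet because the two means differ by
  a constant. Limits along a single orbit would not suffice at the end: the time at which a walk
  leaves a component varies with its length \<open>n\<close>. Hence the upper estimates read
  \<open>rate * n + \<delta> * (s + n) + C\<close>, with \<open>C\<close> independent of the
  starting time \<open>s\<close>; \<open>sublinear\<close> is the matching one-sided little-o. Time
  runs against walks: the first arc of a walk uses the latest matrix.\<close>

definition sublinear :: "(nat \<Rightarrow> real) \<Rightarrow> bool" where
  "sublinear u \<longleftrightarrow> (\<forall>\<epsilon>>0. \<exists>C. \<forall>n. u n \<le> \<epsilon> * real n + C)"

lemma sublinearD:
  assumes "sublinear u" "\<epsilon> > 0"
  obtains C where "\<And>n. u n \<le> \<epsilon> * real n + C"
  using assms unfolding sublinear_def by blast

text \<open>Countably many tolerances suffice, so a statement about all \<epsilon> can hold outside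
  a single null set.\<close>

lemma sublinearI_inverse:
  assumes "\<And>k::nat. \<exists>C. \<forall>n. u n \<le> inverse (real (Suc k)) * real n + C"
  shows "sublinear u"
  unfolding sublinear_def
proof (intro allI impI)
  fix \<epsilon> :: real assume "\<epsilon> > 0"
  then obtain k where k: "inverse (real (Suc k)) < \<epsilon>" using reals_Archimedean by blast
  obtain C where C: "\<And>n. u n \<le> inverse (real (Suc k)) * real n + C" using assms by blast
  have "u n \<le> \<epsilon> * real n + C" for n
    using C[of n] mult_right_mono[OF less_imp_le[OF k], of "real n"] by linarith
  then show "\<exists>C. \<forall>n. u n \<le> \<epsilon> * real n + C" by blast
qed

definition birkhoff_sum :: "('w \<Rightarrow> 'w) \<Rightarrow> ('w \<Rightarrow> real) \<Rightarrow> nat \<Rightarrow> 'w \<Rightarrow> real" where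
  "birkhoff_sum T f n \<omega> = (\<Sum>k<n. f ((T ^^ k) \<omega>))"

lemma birkhoff_sum_0 [simp]: "birkhoff_sum T f 0 \<omega> = 0"
  by (simp add: birkhoff_sum_def)

lemma birkhoff_sum_Suc: "birkhoff_sum T f (Suc n) \<omega> = birkhoff_sum T f n \<omega> + f ((T ^^ n) \<omega>)"
  by (simp add: birkhoff_sum_def)

lemma birkhoff_sum_add:
  "birkhoff_sum T f (m + n) \<omega> = birkhoff_sum T f m ((T ^^ n) \<omega>) + birkhoff_sum T f n \<omega>"
  by (induction m) (simp_all add: birkhoff_sum_Suc funpow_add)

lemma birkhoff_sum_Suc_shift: "birkhoff_sum T f (Suc n) \<omega> = f \<omega> + birkhoff_sum T f n (T \<omega>)"
  using birkhoff_sum_add[of T f n 1 \<omega>] by (simp add: birkhoff_sum_def)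

section \<open>Measure-preserving maps, their iterates, and ergodicity\<close>

locale measure_preserving_system = prob_space P for P :: "'w measure" +
  fixes T :: "'w \<Rightarrow> 'w"
  assumes preserving: "measure_preserving_map P T"
begin

lemma T_measurable [measurable]: "T \<in> measurable P P"
  using preserving by (simp add: measure_preserving_map_def)

lemma distr_T: "distr P P T = P"
  using preserving by (simp add: measure_preserving_map_def)

lemma funpow_measurable [measurable]: "(T ^^ n) \<in> measurable P P"
  by (induction n) (auto simp: o_def id_def[abs_def] intro: measurable_compose[OF _ T_measurable])

lemma distr_funpow: "distr P P (T ^^ n) = P"
proof (induction n)
  case 0
  have "distr P P id = P" by (simp add: id_def)
  then show ?case by simp
next
  case (Suc n)
  have "distr P P (T ^^ Suc n) = distr (distr P P (T ^^ n)) P T"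
    by (subst distr_distr) auto
  then show ?case by (simp only: Suc distr_T)
qed

lemma measure_preserving_funpow: "measure_preserving_map P (T ^^ n)"
  by (simp add: measure_preserving_map_def distr_funpow)

lemma AE_funpow:
  assumes "AE \<omega> in P. Q \<omega>"
  shows "AE \<omega> in P. Q ((T ^^ n) \<omega>)"
proof -
  have "AE \<omega> in distr P P (T ^^ n). Q \<omega>" using assms by (subst distr_funpow)
  then show ?thesis by (rule AE_distrD[OF funpow_measurable])
qed

lemma AE_all_funpow:
  assumes "AE \<omega> in P. Q \<omega>"
  shows "AE \<omega> in P. \<forall>n. Q ((T ^^ n) \<omega>)"
  using AE_funpow[OF assms] by (simp add: AE_all_countable)

lemma integrable_funpow:
  fixes f :: "'w \<Rightarrow> real"
  assumes "integrable P f"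
  shows "integrable P (\<lambda>\<omega>. f ((T ^^ n) \<omega>))"
  using assms integrable_distr[OF funpow_measurable, of n f] by (simp add: distr_funpow)

lemma integral_funpow:
  fixes f :: "'w \<Rightarrow> real"
  assumes "integrable P f"
  shows "(\<integral>\<omega>. f ((T ^^ n) \<omega>) \<partial>P) = integral\<^sup>L P f"
  using integral_distr[OF funpow_measurable, of f n] assms by (simp add: distr_funpow)

lemma integrable_birkhoff_sum: "integrable P f \<Longrightarrow> integrable P (birkhoff_sum T f n)"
  unfolding birkhoff_sum_def by (intro Bochner_Integration.integrable_sum integrable_funpow)

lemma integral_birkhoff_sum:
  "integrable P f \<Longrightarrow> integral\<^sup>L P (birkhoff_sum T f n) = real n * integral\<^sup>L P f"
  unfolding birkhoff_sum_def
  by (subst Bochner_Integration.integral_sum) (auto simp: integrable_funpow integral_funpow)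

end

locale ergodic_system = measure_preserving_system P T for P :: "'w measure" and T +
  assumes ergodic: "ergodic_map P T"
begin

text \<open>
  If the partial sums were almost surely unbounded, then \<open>F (Suc n) - F n \<circ> T\<close> would converge to
  \<open>f\<close> under the bound \<open>\<bar>f\<bar>\<close>; its integrals are nonnegative because \<open>F\<close> is increasing.
\<close>

lemma AE_birkhoff_sum_bounded_above:
  assumes f: "integrable P f" and neg: "integral\<^sup>L P f < 0"
  shows "AE \<omega> in P. \<exists>C. \<forall>n. birkhoff_sum T f n \<omega> \<le> C"
proof -
  \<comment> \<open>\<open>F n\<close> is the maximum of the Birkhoff sums of lengths 0 to n. The
    recursion starts at the beginning of the orbit, so that \<open>F (Suc n)\<close> can be compared
    with \<open>F n\<close> at \<open>T \<omega>\<close>.\<close>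
  define F where "F = rec_nat (\<lambda>_. 0) (\<lambda>_ g \<omega>. max 0 (f \<omega> + g (T \<omega>)))"
  have F0: "F 0 \<omega> = 0" and FS: "F (Suc n) \<omega> = max 0 (f \<omega> + F n (T \<omega>))" for n \<omega>
    by (simp_all add: F_def)
  have [measurable]: "f \<in> borel_measurable P" using f by simp
  have F_int: "integrable P (F n)" for n
  proof (induction n)
    case 0 then show ?case by (simp add: F_def)
  next
    case (Suc n)
    have "integrable P (\<lambda>\<omega>. f \<omega> + F n (T \<omega>))" using f integrable_funpow[OF Suc, of 1] by simp
    then have "integrable P (\<lambda>\<omega>. max 0 (f \<omega> + F n (T \<omega>)))" by simp
    moreover have "F (Suc n) = (\<lambda>\<omega>. max 0 (f \<omega> + F n (T \<omega>)))" by (auto simp: FS)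
    ultimately show ?case by simp
  qed
  have [measurable]: "F n \<in> borel_measurable P" for n using F_int[of n] by simp
  have F_nonneg: "F n \<omega> \<ge> 0" for n \<omega> by (cases n) (simp_all add: F0 FS)
  have F_Suc: "F n \<omega> \<le> F (Suc n) \<omega>" for n \<omega>
  proof (induction n arbitrary: \<omega>)
    case 0 show ?case by (simp add: F0 FS)
  next
    case (Suc n)
    show ?case using Suc[of "T \<omega>"] unfolding FS[of _ \<omega>] by linarith
  qed
  have F_mono: "F m \<omega> \<le> F n \<omega>" if "m \<le> n" for m n \<omega>
    using lift_Suc_mono_le[of "\<lambda>n. F n \<omega>", OF F_Suc that] .
  have F_ge: "birkhoff_sum T f n \<omega> \<le> F n \<omega>" for n \<omega>
  proof (induction n arbitrary: \<omega>)
    case (Suc n)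
    then show ?case using Suc[of "T \<omega>"] by (simp add: FS birkhoff_sum_Suc_shift le_max_iff_disj)
  qed (simp add: F0)
  \<comment> \<open>Natural thresholds \<open>C\<close> keep the set measurable. It is invariant
    because \<open>F (Suc n) \<omega>\<close> and \<open>F n (T \<omega>)\<close> differ by at most
    \<open>\<bar>f \<omega>\<bar>\<close>, so both are unbounded or neither is.\<close>
  define U where "U = {\<omega>\<in>space P. \<forall>C::nat. \<exists>n. real C < F n \<omega>}"
  have U_sets: "U \<in> sets P" unfolding U_def by measurable
  have U_iff: "T \<omega> \<in> U \<longleftrightarrow> \<omega> \<in> U" if "\<omega> \<in> space P" for \<omega>
  proof -
    have TS: "T \<omega> \<in> space P" using that measurable_space[OF T_measurable] by blast
    have "\<exists>n. real C < F n (T \<omega>)" if U: "\<forall>C::nat. \<exists>n. real C < F n \<omega>" for C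
    proof -
      obtain C' :: nat where C': "real C + f \<omega> < real C'" using reals_Archimedean2 by blast
      obtain n where n: "real C' < F n \<omega>" using U by blast
      have "real C' < F (Suc n) \<omega>" using n F_Suc[of n \<omega>] by linarith
      then have "real C < F n (T \<omega>)" using C' of_nat_0_le_iff[of C', where ?'a=real] unfolding FS by linarith
      then show ?thesis by blast
    qed
    moreover have "\<exists>n. real C < F n \<omega>" if U: "\<forall>C::nat. \<exists>n. real C < F n (T \<omega>)" for C
    proof -
      obtain C' :: nat where C': "real C - f \<omega> < real C'" using reals_Archimedean2 by blast
      obtain n where n: "real C' < F n (T \<omega>)" using U by blast
      have "real C < F (Suc n) \<omega>" using n C' unfolding FS by linarith
      then show ?thesis by blast
    qed
    ultimately show ?thesis using that TS unfolding U_def by blast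
  qed
  have "T -` U \<inter> space P = U" using U_iff by (auto simp: U_def)
  then have "measure P U = 0 \<or> measure P U = 1"
    using ergodic U_sets unfolding ergodic_map_def by blast
  moreover have "measure P U \<noteq> 1"
  proof
    assume "measure P U = 1"
    then have AEU: "AE \<omega> in P. \<omega> \<in> U" using U_sets by (simp add: prob_eq_1)
    define D where "D n \<omega> = F (Suc n) \<omega> - F n (T \<omega>)" for n \<omega>
    have D: "D n \<omega> = max (- F n (T \<omega>)) (f \<omega>)" for n \<omega> by (simp add: D_def FS)
    have [measurable]: "D n \<in> borel_measurable P" for n unfolding D_def by measurable
    have FT: "integrable P (\<lambda>\<omega>. F n (T \<omega>))" "(\<integral>\<omega>. F n (T \<omega>) \<partial>P) = integral\<^sup>L P (F n)" for n
      using integrable_funpow[OF F_int, of n 1] integral_funpow[OF F_int, of n 1] by auto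
    have D_nonneg: "integral\<^sup>L P (D n) \<ge> 0" for n
    proof -
      have "integral\<^sup>L P (D n) = integral\<^sup>L P (F (Suc n)) - integral\<^sup>L P (F n)"
        unfolding D_def using F_int FT by (subst Bochner_Integration.integral_diff) auto
      moreover have "integral\<^sup>L P (F n) \<le> integral\<^sup>L P (F (Suc n))"
        by (intro integral_mono F_int F_Suc)
      ultimately show ?thesis by simp
    qed
    have "(\<lambda>n. integral\<^sup>L P (D n)) \<longlonglongrightarrow> integral\<^sup>L P f"
    proof (rule integral_dominated_convergence)
      show "integrable P (\<lambda>\<omega>. \<bar>f \<omega>\<bar>)" using f by simp
      show "AE \<omega> in P. (\<lambda>n. D n \<omega>) \<longlonglongrightarrow> f \<omega>"
        using AEU AE_space
      proof eventually_elim
        case (elim \<omega>)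
        then have "T \<omega> \<in> U" using U_iff by blast
        obtain C :: nat where C: "- f \<omega> < real C" using reals_Archimedean2 by blast
        obtain n where n: "real C < F n (T \<omega>)" using \<open>T \<omega> \<in> U\<close> unfolding U_def by blast
        have "D k \<omega> = f \<omega>" if "k \<ge> n" for k
          using n C F_mono[OF that, of "T \<omega>"] unfolding D by linarith
        then have "\<forall>\<^sub>F k in sequentially. D k \<omega> = f \<omega>"
          unfolding eventually_sequentially by blast
        then show ?case by (rule tendsto_eventually)
      qed
      show "AE \<omega> in P. norm (D n \<omega>) \<le> \<bar>f \<omega>\<bar>" for n
      proof (rule AE_I2)
        show "norm (D n \<omega>) \<le> \<bar>f \<omega>\<bar>" for \<omega>
          using F_nonneg[of n "T \<omega>"] unfolding D real_norm_def by linarith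
      qed
    qed auto
    then have "integral\<^sup>L P f \<ge> 0" using D_nonneg by (intro LIMSEQ_le_const) auto
    then show False using neg by simp
  qed
  ultimately have "measure P U = 0" by blast
  then have "AE \<omega> in P. \<omega> \<notin> U" using U_sets by (simp add: prob_eq_0)
  with AE_space show ?thesis
  proof eventually_elim
    case (elim \<omega>)
    then obtain C :: nat where C: "\<And>n. F n \<omega> \<le> real C" unfolding U_def by (auto simp: not_less)
    then show ?case using F_ge order_trans by blast
  qed
qed

text \<open>Subtracting the mean plus a positive slack makes the integral negative, so the partial
  sums are bounded above; the slack becomes the tolerance.\<close>

lemma AE_birkhoff_upper:
  assumes f: "integrable P f"
  shows "AE \<omega> in P. sublinear (\<lambda>n. birkhoff_sum T f n \<omega> - real n * integral\<^sup>L P f)"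
proof -
  let ?\<mu> = "integral\<^sup>L P f"
  have "AE \<omega> in P. \<forall>k::nat. \<exists>C. \<forall>n.
    birkhoff_sum T (\<lambda>\<omega>. f \<omega> - (?\<mu> + inverse (real (Suc k)))) n \<omega> \<le> C"
  proof (subst AE_all_countable, intro allI AE_birkhoff_sum_bounded_above)
    show "integrable P (\<lambda>\<omega>. f \<omega> - (?\<mu> + inverse (real (Suc k))))" for k using f by simp
    show "(\<integral>\<omega>. f \<omega> - (?\<mu> + inverse (real (Suc k))) \<partial>P) < 0" for k
      using f by (subst Bochner_Integration.integral_diff) (auto simp: prob_space)
  qed
  then show ?thesis
  proof eventually_elim
    case (elim \<omega>)
    show ?case
    proof (rule sublinearI_inverse)
      fix k :: nat
      obtain C where C: "\<And>n. birkhoff_sum T (\<lambda>\<omega>. f \<omega> - (?\<mu> + inverse (real (Suc k)))) n \<omega> \<le> C"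
        using elim by blast
      have "birkhoff_sum T f n \<omega> - real n * ?\<mu> \<le> inverse (real (Suc k)) * real n + C" for n
        using C[of n] by (simp add: birkhoff_sum_def sum_subtractf algebra_simps)
      then show "\<exists>C. \<forall>n. birkhoff_sum T f n \<omega> - real n * ?\<mu> \<le> inverse (real (Suc k)) * real n + C"
        by blast
    qed
  qed
qed

theorem AE_birkhoff:
  assumes f: "integrable P f"
  shows "AE \<omega> in P. sublinear (\<lambda>n. \<bar>birkhoff_sum T f n \<omega> - real n * integral\<^sup>L P f\<bar>)"
proof -
  have "integrable P (\<lambda>\<omega>. - f \<omega>)" using f by simp
  from AE_birkhoff_upper[OF f] AE_birkhoff_upper[OF this] show ?thesis
  proof eventually_elim
    case (elim \<omega>)
    let ?u = "\<lambda>n. birkhoff_sum T f n \<omega> - real n * integral\<^sup>L P f"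
    have minus: "sublinear (\<lambda>n. - ?u n)"
      using elim(2) by (simp add: birkhoff_sum_def sum_negf)
    show ?case
      unfolding sublinear_def
    proof (intro allI impI)
      fix \<epsilon> :: real assume e: "\<epsilon> > 0"
      obtain C where C: "\<And>n. ?u n \<le> \<epsilon> * real n + C" using sublinearD[OF elim(1) e] by blast
      obtain D where D: "\<And>n. - ?u n \<le> \<epsilon> * real n + D" using sublinearD[OF minus e] by blast
      have "\<bar>?u n\<bar> \<le> \<epsilon> * real n + max C D" for n using C[of n] D[of n] by linarith
      then show "\<exists>C. \<forall>n. \<bar>?u n\<bar> \<le> \<epsilon> * real n + C" by blast
    qed
  qed
qed

text \<open>A single term is the difference of two consecutive Birkhoff sums of \<bar>f\<bar>, and
  both are close to the same linear function.\<close>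

lemma AE_sublinear_orbit:
  assumes f: "integrable P f"
  shows "AE \<omega> in P. sublinear (\<lambda>n. \<bar>f ((T ^^ n) \<omega>)\<bar>)"
proof -
  let ?g = "\<lambda>\<omega>. \<bar>f \<omega>\<bar>"
  have "integrable P ?g" using f by simp
  from AE_birkhoff[OF this] show ?thesis
  proof eventually_elim
    case (elim \<omega>)
    let ?\<mu> = "integral\<^sup>L P ?g"
    show ?case
      unfolding sublinear_def
    proof (intro allI impI)
      fix \<epsilon> :: real assume "\<epsilon> > 0"
      then have "\<epsilon> / 2 > 0" by simp
      then obtain C where C: "\<And>n. \<bar>birkhoff_sum T ?g n \<omega> - real n * ?\<mu>\<bar> \<le> \<epsilon> / 2 * real n + C"
        using sublinearD[OF elim] by blast
      \<comment> \<open>The two sums contribute \<open>C\<close> each; passing from \<open>n\<close>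
        to \<open>Suc n\<close> contributes one mean and one extra \<epsilon>/2.\<close>
      have "?g ((T ^^ n) \<omega>) \<le> \<epsilon> * real n + (?\<mu> + \<epsilon> / 2 + 2 * C)" for n
      proof -
        have "\<bar>birkhoff_sum T ?g n \<omega> + ?g ((T ^^ n) \<omega>) - (real n * ?\<mu> + ?\<mu>)\<bar>
            \<le> \<epsilon> / 2 * real n + \<epsilon> / 2 + C"
          using C[of "Suc n"] unfolding birkhoff_sum_Suc by (simp add: algebra_simps add_divide_distrib)
        moreover have "\<epsilon> / 2 * real n + \<epsilon> / 2 * real n = \<epsilon> * real n" by simp
        ultimately show ?thesis using C[of n] by linarith
      qed
      then show "\<exists>C. \<forall>n. ?g ((T ^^ n) \<omega>) \<le> \<epsilon> * real n + C" by blast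
    qed
  qed
qed

end


section \<open>Subadditive sequences over an ergodic map\<close>

text \<open>
  Summing \<open>u s (k + N) - u s k \<le> u (s + k) N\<close> over \<open>k\<close> telescopes on the left, which bounds a
  block of \<open>N\<close> consecutive values of \<open>u s\<close> by the sums of \<open>u \<cdot> N\<close> along the orbit.
\<close>

lemma subadditive_array_upper:
  fixes u :: "nat \<Rightarrow> nat \<Rightarrow> real"
  assumes sub: "\<And>s m n. m \<ge> n0 \<Longrightarrow> n \<ge> n0 \<Longrightarrow> u s (m + n) \<le> u (s + n) m + u s n"
    and N: "N \<ge> n0" "N > 0"
    and H: "\<And>s j. n0 \<le> j \<Longrightarrow> j \<le> 2 * n0 + N \<Longrightarrow> \<bar>u s j\<bar> \<le> H s" "sublinear H"
    and B: "sublinear (\<lambda>n. \<bar>(\<Sum>k<n. u k N) - real n * \<mu>\<bar>)"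
    and \<mu>: "\<mu> \<le> c * real N" and \<epsilon>: "\<epsilon> > 0"
  shows "\<exists>C. \<forall>s m. m \<ge> n0 \<longrightarrow> u s m \<le> c * real m + \<epsilon> * real (s + m) + C"
proof -
  \<comment> \<open>Four errors of size \<open>e * t\<close> occur: one at each end of the window,
    and two in comparing Birkhoff sums.\<close>
  define e where "e = \<epsilon> / 4"
  have e: "e > 0" using \<epsilon> by (simp add: e_def)
  obtain C1' where "\<And>n. H n \<le> e * real n + C1'" using sublinearD[OF H(2) e] by blast
  then have C1: "H n \<le> e * real n + \<bar>C1'\<bar>" for n by (meson abs_ge_self add_left_mono order_trans)
  define C1 where "C1 = \<bar>C1'\<bar>"
  obtain C2' where C2': "\<And>n. \<bar>(\<Sum>k<n. u k N) - real n * \<mu>\<bar> \<le> e * real n + C2'"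
    using sublinearD[OF B e] by blast
  define C2 where "C2 = \<bar>C2'\<bar>"
  have C2: "\<bar>(\<Sum>k<n. u k N) - real n * \<mu>\<bar> \<le> e * real n + C2" for n
    using C2'[of n] unfolding C2_def by linarith
  \<comment> \<open>\<open>N + 2 * n0\<close> is the number of time steps that the middle sum below
    does not count; the last term pays for their linear growth.\<close>
  define C where "C = 2 * C1 + 2 * C2 + \<bar>c\<bar> * real (N + 2 * n0)"
  have "u s m \<le> c * real m + \<epsilon> * real (s + m) + C" if m: "m \<ge> n0" for s m
  proof (cases "m \<le> 2 * n0 + N")
    case True
    have "u s m \<le> e * real s + C1" using H(1)[OF m True, of s] C1[of s] unfolding C1_def by linarith
    moreover have "e * real s \<le> \<epsilon> * real (s + m)" using \<epsilon> by (intro mult_mono) (auto simp: e_def)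
    moreover have "\<bar>c\<bar> * real m \<le> \<bar>c\<bar> * real (N + 2 * n0)" using True by (intro mult_left_mono) auto
    moreover have "- (\<bar>c\<bar> * real m) \<le> c * real m" by (cases "c \<ge> 0") auto
    moreover have "C1 \<ge> 0" "C2 \<ge> 0" by (auto simp: C1_def C2_def)
    ultimately show ?thesis unfolding C_def by linarith
  next
    case False
    \<comment> \<open>With this choice every remainder \<open>m - (M + j)\<close>,
      \<open>j < N\<close>, lies between \<open>n0\<close> and \<open>N + n0\<close>: long enough
      for subadditivity and short enough for the bound \<open>H\<close>.\<close>
    define M where "M = m - (N + n0)"
    have M: "m = M + N + n0" "M \<ge> n0" using False by (auto simp: M_def)
    define t where "t = real (s + m)"
    have block: "(\<Sum>j<N. u s (M + j)) \<le> (\<Sum>k=n0..<M. u (s + k) N) + (\<Sum>j<N. u s (n0 + j))"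
      using \<open>M \<ge> n0\<close>
    proof (induction M rule: dec_induct)
      case (step k)
      have shift: "(\<Sum>j<N. u s (k + j)) + u s (k + N) = u s k + (\<Sum>j<N. u s (Suc k + j))"
        using sum.lessThan_Suc[of "\<lambda>j. u s (k + j)" N] sum.lessThan_Suc_shift[of "\<lambda>j. u s (k + j)" N]
        by simp
      have "u s (N + k) \<le> u (s + k) N + u s k" using sub[of N k s] N step by auto
      then show ?case using step shift by (simp add: add.commute)
    qed simp
    have head: "(\<Sum>j<N. u s (n0 + j)) \<le> real N * (e * t + C1)"
    proof -
      have "u s (n0 + j) \<le> e * t + C1" if "j < N" for j
      proof -
        have "u s (n0 + j) \<le> e * real s + C1"
          using H(1)[of "n0 + j" s] that C1[of s] unfolding C1_def by auto
        also have "e * real s \<le> e * t" using e by (simp add: t_def)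
        finally show ?thesis by simp
      qed
      then have "(\<Sum>j<N. u s (n0 + j)) \<le> (\<Sum>j<N. e * t + C1)" by (intro sum_mono) simp
      then show ?thesis by simp
    qed
    \<comment> \<open>Averages over the \<open>N\<close> ways to cut the window at
      \<open>M + j\<close>; the late piece is bounded by \<open>H\<close>.\<close>
    have last: "real N * u s m \<le> real N * (e * t + C1) + (\<Sum>j<N. u s (M + j))"
    proof -
      have "u s m \<le> (e * t + C1) + u s (M + j)" if "j < N" for j
      proof -
        have "u s ((N + n0 - j) + (M + j)) \<le> u (s + (M + j)) (N + n0 - j) + u s (M + j)"
          using that M by (intro sub) auto
        moreover have "(N + n0 - j) + (M + j) = m" using that M by simp
        moreover have "u (s + (M + j)) (N + n0 - j) \<le> e * real (s + (M + j)) + C1"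
        proof -
          have "\<bar>u (s + (M + j)) (N + n0 - j)\<bar> \<le> H (s + (M + j))" using that by (intro H(1)) auto
          then show ?thesis using C1[of "s + (M + j)"] unfolding C1_def by linarith
        qed
        moreover have "e * real (s + (M + j)) \<le> e * t" using e that M by (auto simp: t_def)
        ultimately show ?thesis by simp
      qed
      then have "(\<Sum>j<N. u s m) \<le> (\<Sum>j<N. (e * t + C1) + u s (M + j))" by (intro sum_mono) simp
      then show ?thesis by (simp add: sum.distrib)
    qed
    \<comment> \<open>A sum over a shifted window is a difference of two sums from time 0. Their
      errors grow with the end of the window, hence \<open>s + m\<close> instead of \<open>m\<close>
      in the conclusion.\<close>
    have mid: "(\<Sum>k=n0..<M. u (s + k) N) \<le> real (M - n0) * \<mu> + 2 * (e * t + C2)"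
    proof -
      have "(\<Sum>k=n0..<M. u (s + k) N) = (\<Sum>k=s+n0..<s+M. u k N)"
        using sum.shift_bounds_nat_ivl[of "\<lambda>k. u k N" n0 s M] by (simp add: add.commute)
      also have "\<dots> = (\<Sum>k<s+M. u k N) - (\<Sum>k<s+n0. u k N)"
        using sum_diff_nat_ivl[of 0 "s + n0" "s + M" "\<lambda>k. u k N"] M by (simp add: atLeast0LessThan)
      finally have eq: "(\<Sum>k=n0..<M. u (s + k) N) = (\<Sum>k<s+M. u k N) - (\<Sum>k<s+n0. u k N)" .
      have "(\<Sum>k<s+M. u k N) \<le> real (s + M) * \<mu> + e * real (s + M) + C2"
        using C2[of "s + M"] by linarith
      moreover have "(\<Sum>k<s+n0. u k N) \<ge> real (s + n0) * \<mu> - e * real (s + n0) - C2"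
        using C2[of "s + n0"] by linarith
      moreover have "e * real (s + M) \<le> e * t" "e * real (s + n0) \<le> e * t"
        using e M by (auto simp: t_def)
      moreover have "real (s + M) * \<mu> - real (s + n0) * \<mu> = real (M - n0) * \<mu>"
        using M by (simp add: of_nat_diff algebra_simps)
      ultimately show ?thesis unfolding eq by (simp add: algebra_simps)
    qed
    have "real N * u s m \<le> 2 * (real N * (e * t + C1)) + real (M - n0) * \<mu> + 2 * (e * t + C2)"
      using block head last mid by linarith
    also have "real (M - n0) * \<mu> \<le> real (M - n0) * (c * real N)" using \<mu> by (intro mult_left_mono) auto
    also have "real (M - n0) * (c * real N) = real N * (c * real m - c * real (N + 2 * n0))"
      using M by (simp add: of_nat_diff algebra_simps)
    also have "\<dots> \<le> real N * (c * real m + \<bar>c\<bar> * real (N + 2 * n0))"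
    proof -
      have "- (c * real (N + 2 * n0)) \<le> \<bar>c\<bar> * real (N + 2 * n0)"
        by (metis abs_ge_minus_self mult_minus_left mult_right_mono of_nat_0_le_iff)
      then show ?thesis by (intro mult_left_mono) auto
    qed
    also have "2 * (e * t + C2) \<le> real N * (2 * (e * t + C2))"
    proof -
      have "0 \<le> 2 * (e * t + C2)" using e by (auto simp: t_def C2_def)
      moreover have "1 \<le> real N" using N by simp
      ultimately show ?thesis using mult_right_mono[of 1 "real N"] by simp
    qed
    finally have "real N * u s m \<le> real N * (c * real m + 4 * e * t + C)"
      unfolding C_def by (simp add: algebra_simps)
    then have "u s m \<le> c * real m + 4 * e * t + C" using N by simp
    then show ?thesis by (simp add: e_def t_def)
  qed
  then show ?thesis by blast
qed

context ergodic_system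
begin

text \<open>The easy half of Kingman's theorem, uniformly in the window: one block length
  \<open>N\<close> with a small mean controls all longer windows. The threshold \<open>n0\<close> is
  there because short products may fail to be finite.\<close>

lemma AE_subadditive_upper:
  fixes f :: "nat \<Rightarrow> 'w \<Rightarrow> real"
  assumes int: "\<And>m. m \<ge> n0 \<Longrightarrow> integrable P (f m)"
    and sub: "\<And>m n \<omega>. m \<ge> n0 \<Longrightarrow> n \<ge> n0 \<Longrightarrow> f (m + n) \<omega> \<le> f m ((T ^^ n) \<omega>) + f n \<omega>"
    and N: "N \<ge> n0" "N > 0" "integral\<^sup>L P (f N) \<le> c * real N"
  shows "AE \<omega> in P. \<forall>\<epsilon>>0. \<exists>C. \<forall>s m. m \<ge> n0 \<longrightarrow>
    f m ((T ^^ s) \<omega>) \<le> c * real m + \<epsilon> * real (s + m) + C"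
proof -
  define H where "H \<omega> = (\<Sum>j=n0..2*n0+N. \<bar>f j \<omega>\<bar>)" for \<omega>
  have "integrable P H" unfolding H_def using int by (intro Bochner_Integration.integrable_sum) auto
  from AE_sublinear_orbit[OF this] AE_birkhoff[OF int[OF N(1)]] show ?thesis
  proof eventually_elim
    case (elim \<omega>)
    show ?case
    proof (intro allI impI)
      fix \<epsilon> :: real assume \<epsilon>: "\<epsilon> > 0"
      show "\<exists>C. \<forall>s m. m \<ge> n0 \<longrightarrow> f m ((T ^^ s) \<omega>) \<le> c * real m + \<epsilon> * real (s + m) + C"
      proof (rule subadditive_array_upper[where N = N and \<mu> = "integral\<^sup>L P (f N)"
          and H = "\<lambda>s. \<bar>H ((T ^^ s) \<omega>)\<bar>"])
        show "f (m + n) ((T ^^ s) \<omega>) \<le> f m ((T ^^ (s + n)) \<omega>) + f n ((T ^^ s) \<omega>)"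
          if "m \<ge> n0" "n \<ge> n0" for s m n
          using sub[OF that, of "(T ^^ s) \<omega>"] by (simp add: funpow_add[symmetric] add.commute
            flip: comp_apply[of "T ^^ n" "T ^^ s"])
        show "\<bar>f j ((T ^^ s) \<omega>)\<bar> \<le> \<bar>H ((T ^^ s) \<omega>)\<bar>" if "n0 \<le> j" "j \<le> 2 * n0 + N" for s j
        proof -
          have "\<bar>f j ((T ^^ s) \<omega>)\<bar> \<le> H ((T ^^ s) \<omega>)"
            unfolding H_def using that by (intro member_le_sum) auto
          then show ?thesis by linarith
        qed
        show "sublinear (\<lambda>s. \<bar>H ((T ^^ s) \<omega>)\<bar>)" using elim(1) .
        show "sublinear (\<lambda>n. \<bar>(\<Sum>k<n. f N ((T ^^ k) \<omega>)) - real n * integral\<^sup>L P (f N)\<bar>)"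
          using elim(2) by (simp add: birkhoff_sum_def)
      qed (use N \<epsilon> in auto)
    qed
  qed
qed

end


section \<open>Periods of strongly connected relations\<close>

text \<open>A numerical semigroup contains all large multiples of its gcd. The gcd is obtained as
  the least positive difference of two elements, which comes with the elements \<open>b\<close> and
  \<open>b + g\<close> needed for the second part.\<close>

lemma additive_set_period:
  fixes R :: "nat set"
  assumes zero: "0 \<in> R" and add: "\<And>a b. a \<in> R \<Longrightarrow> b \<in> R \<Longrightarrow> a + b \<in> R"
    and pos: "\<exists>a\<in>R. a > 0"
  obtains g K where "g > 0" "\<And>a. a \<in> R \<Longrightarrow> g dvd a" "\<And>n. n \<ge> K \<Longrightarrow> g * n \<in> R"
proof -
  have mult: "q * b \<in> R" if "b \<in> R" for q b
    using that by (induction q) (auto simp: zero add)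
  define D where "D g \<longleftrightarrow> g > 0 \<and> (\<exists>b\<in>R. b + g \<in> R)" for g
  define g where "g = (LEAST g. D g)"
  have "\<exists>g. D g" using zero pos unfolding D_def by force
  then have Dg: "D g" unfolding g_def by (rule LeastI_ex)
  then obtain b where b: "b \<in> R" "b + g \<in> R" and g: "g > 0" unfolding D_def by blast
  have dvd: "g dvd a" if a: "a \<in> R" for a
  proof (rule ccontr)
    assume "\<not> g dvd a"
    then have r: "a mod g > 0" by (simp add: dvd_eq_mod_eq_0)
    \<comment> \<open>Two elements of \<open>R\<close> at distance \<open>a mod g\<close>, against
      the minimality of \<open>g\<close>.\<close>
    have "a div g * (b + g) + a mod g = a + a div g * b" by (simp add: algebra_simps)
    then have "a div g * (b + g) + a mod g \<in> R" using add[OF a mult[OF b(1), of "a div g"]] by simp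
    then have "D (a mod g)" using r mult[OF b(2)] unfolding D_def by blast
    then have "g \<le> a mod g" unfolding g_def by (rule Least_le)
    moreover have "a mod g < g" using g by simp
    ultimately show False by simp
  qed
  obtain b' where b': "b = g * b'" using dvd[OF b(1)] by blast
  \<comment> \<open>Writing \<open>n = u * b' + v\<close> with \<open>v < b'\<close>, the bound
    \<open>b' * b'\<close> forces \<open>v \<le> u\<close>. Then \<open>g * n\<close> consists of
    \<open>v\<close> copies of \<open>b + g\<close> and \<open>u - v\<close> copies of
    \<open>b\<close>.\<close>
  have "g * n \<in> R" if n: "n \<ge> b' * b'" for n
  proof (cases "b' = 0")
    case True
    then show ?thesis using mult[OF b(2), of n] b' by (simp add: mult.commute)
  next
    case False
    define v where "v = n mod b'"
    define u where "u = n div b'"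
    have nuv: "n = u * b' + v" by (simp add: u_def v_def)
    have "v < b'" using False by (simp add: v_def)
    moreover have "b' \<le> u" using div_le_mono[OF n, of b'] False by (simp add: u_def)
    ultimately obtain w where w: "u = v + w" using le_Suc_ex[of v u] by auto
    have "g * n = w * b + v * (b + g)" by (simp add: nuv w b' algebra_simps)
    then show ?thesis using add[OF mult[OF b(1)] mult[OF b(2)]] by simp
  qed
  with g dvd show ?thesis by (rule that)
qed

lemma relpow_trans: "(i, k) \<in> E ^^ m \<Longrightarrow> (k, j) \<in> E ^^ n \<Longrightarrow> (i, j) \<in> E ^^ (m + n)"
  by (auto simp: relpow_add)

text \<open>The loop lengths at one node form an additive set, and its gcd is the period of the
  whole component, since any loop can be inserted into a loop at that node. A cycle without
  repetition gives \<open>g \<le> card c\<close>, which brings \<open>g\<close> into the range where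
  ergodicity is assumed.\<close>

lemma strongly_connected_period:
  fixes E :: "('i \<times> 'i) set"
  assumes c: "finite c" "c \<noteq> {}" and conn: "\<And>i j. i \<in> c \<Longrightarrow> j \<in> c \<Longrightarrow> (i, j) \<in> (E \<inter> c \<times> c)\<^sup>+"
  obtains g K where "g \<in> {1..card c}"
    "\<And>i n. i \<in> c \<Longrightarrow> (i, i) \<in> (E \<inter> c \<times> c) ^^ n \<Longrightarrow> g dvd n"
    "\<And>i j l m. i \<in> c \<Longrightarrow> j \<in> c \<Longrightarrow> (i, j) \<in> (E \<inter> c \<times> c) ^^ (g * l) \<Longrightarrow> m \<ge> K \<Longrightarrow>
       (i, j) \<in> (E \<inter> c \<times> c) ^^ (g * m)"
proof -
  let ?E = "E \<inter> c \<times> c"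
  obtain o' where o': "o' \<in> c" using c by blast
  define R where "R = {n. (o', o') \<in> ?E ^^ n}"
  have path: "\<exists>n. (i, j) \<in> ?E ^^ n" if "i \<in> c" "j \<in> c" for i j
    using conn[OF that] by (auto simp: trancl_power)
  have "0 \<in> R" by (simp add: R_def)
  moreover have "a + b \<in> R" if "a \<in> R" "b \<in> R" for a b
    using that relpow_trans unfolding R_def by fast
  moreover have "\<exists>a\<in>R. a > 0" using conn[OF o' o'] unfolding R_def by (auto simp: trancl_power)
  ultimately obtain g K where g: "g > 0" and dvd: "\<And>a. a \<in> R \<Longrightarrow> g dvd a"
    and K: "\<And>n. n \<ge> K \<Longrightarrow> g * n \<in> R"
    using additive_set_period[of R thesis] by blast
  have closed_dvd: "g dvd n" if i: "i \<in> c" and n: "(i, i) \<in> ?E ^^ n" for i n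
  proof -
    obtain k where k: "(o', i) \<in> ?E ^^ k" using path[OF o' i] by blast
    obtain l where l: "(i, o') \<in> ?E ^^ l" using path[OF i o'] by blast
    have "k + l \<in> R" using relpow_trans[OF k l] by (simp add: R_def)
    moreover have "k + n + l \<in> R" using relpow_trans[OF relpow_trans[OF k n] l] by (simp add: R_def)
    ultimately have "g dvd k + l" "g dvd (k + l) + n" using dvd by (auto simp: algebra_simps)
    then show ?thesis by (metis dvd_add_right_iff)
  qed
  have "\<exists>L. \<forall>l. (i, j) \<in> ?E ^^ (g * l) \<longrightarrow> (\<forall>m\<ge>L. (i, j) \<in> ?E ^^ (g * m))"
    if ij: "i \<in> c" "j \<in> c" for i j
  proof -
    obtain k where k: "(i, o') \<in> ?E ^^ k" using path[OF ij(1) o'] by blast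
    obtain k' where k': "(o', j) \<in> ?E ^^ k'" using path[OF o' ij(2)] by blast
    obtain k'' where k'': "(j, i) \<in> ?E ^^ k''" using path[OF ij(2) ij(1)] by blast
    \<comment> \<open>The given walk of length \<open>g * l\<close> only shows that \<open>g\<close>
      divides \<open>k + k'\<close>. The walk of length \<open>g * m\<close> is then routed through
      \<open>o'\<close>, with a loop there making up the length.\<close>
    have "(i, j) \<in> ?E ^^ (g * m)" if l: "(i, j) \<in> ?E ^^ (g * l)" and m: "m \<ge> K + (k + k')" for l m
    proof -
      have "g dvd k + k' + k''" using closed_dvd[OF ij(1) relpow_trans[OF relpow_trans[OF k k'] k'']] .
      moreover have "g dvd g * l + k''" using closed_dvd[OF ij(1) relpow_trans[OF l k'']] .
      then have "g dvd k''" by (simp add: dvd_add_right_iff)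
      ultimately have "g dvd k + k'" by (simp add: dvd_add_left_iff)
      then obtain u where u: "k + k' = g * u" by blast
      have "u \<le> k + k'" using u g by simp
      then have w: "m = (m - u) + u" "m - u \<ge> K" using m by auto
      define w where "w = m - u"
      have loop: "(o', o') \<in> ?E ^^ (g * w)" using K[OF w(2)] by (simp add: R_def w_def)
      have "(i, j) \<in> ?E ^^ (k + g * w + k')" using relpow_trans[OF relpow_trans[OF k loop] k'] .
      moreover have "k + g * w + k' = g * m" using u w(1) unfolding w_def
        by (metis add.assoc add.commute add_mult_distrib2)
      ultimately show ?thesis by simp
    qed
    then show ?thesis by blast
  qed
  then obtain L where L: "\<And>i j l m. i \<in> c \<Longrightarrow> j \<in> c \<Longrightarrow> (i, j) \<in> ?E ^^ (g * l) \<Longrightarrow> m \<ge> L i j \<Longrightarrow>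
      (i, j) \<in> ?E ^^ (g * m)" by metis
  define K' where "K' = Max ((\<lambda>(i, j). L i j) ` (c \<times> c))"
  have K': "L i j \<le> K'" if "i \<in> c" "j \<in> c" for i j
    unfolding K'_def using c that by (intro Max_ge) auto
  have "g \<le> card c"
  proof -
    have "\<forall>i\<in>c. \<exists>j\<in>c. (i, j) \<in> ?E"
    proof
      fix i assume "i \<in> c"
      then show "\<exists>j\<in>c. (i, j) \<in> ?E" using tranclD[OF conn[of i i]] by blast
    qed
    \<comment> \<open>Following one successor per node, the first \<open>card c + 1\<close>
      positions contain a repetition, hence a closed walk of length at most
      \<open>card c\<close>.\<close>
    then obtain \<sigma> where \<sigma>: "\<And>i. i \<in> c \<Longrightarrow> \<sigma> i \<in> c \<and> (i, \<sigma> i) \<in> ?E" by metis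
    have orbit: "(\<sigma> ^^ n) o' \<in> c" for n by (induction n) (auto simp: o' \<sigma>)
    have walk: "((\<sigma> ^^ a) o', (\<sigma> ^^ (a + n)) o') \<in> ?E ^^ n" for a n
      using \<sigma>[OF orbit] by (induction n) (auto intro!: relcompI)
    have "\<not> inj_on (\<lambda>n. (\<sigma> ^^ n) o') {..card c}"
    proof
      assume "inj_on (\<lambda>n. (\<sigma> ^^ n) o') {..card c}"
      then have "card {..card c} \<le> card c"
        using orbit c by (intro card_inj_on_le[of "\<lambda>n. (\<sigma> ^^ n) o'"]) auto
      then show False by simp
    qed
    then obtain a b where ab: "a < b" "b \<le> card c" "(\<sigma> ^^ a) o' = (\<sigma> ^^ b) o'"
      unfolding inj_on_def by (metis atMost_iff nat_neq_iff)
    have "g dvd b - a" using walk[of a "b - a"] ab closed_dvd[OF orbit[of a]] by simp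
    then have "g \<le> b - a" using ab by (intro dvd_imp_le) auto
    then show ?thesis using ab by simp
  qed
  show ?thesis
  proof (rule that[of g K'])
    show "g \<in> {1..card c}" using g \<open>g \<le> card c\<close> by simp
    show "g dvd n" if "i \<in> c" "(i, i) \<in> ?E ^^ n" for i n
      using closed_dvd that by blast
    show "(i, j) \<in> ?E ^^ (g * m)" if "i \<in> c" "j \<in> c" "(i, j) \<in> ?E ^^ (g * l)" "m \<ge> K'" for i j l m
      using L[OF that(1-3), of m] K'[OF that(1,2)] that(4) by linarith
  qed
qed


section \<open>Cocycle inequalities for max-plus products\<close>

lemma Max_image_attained:
  assumes "finite I" "I \<noteq> {}"
  obtains k where "k \<in> I" "(MAX k\<in>I. f k) = f k"
proof -
  have "Max (f ` I) \<in> f ` I" using assms by (intro Max_in) auto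
  then show ?thesis using that by auto
qed

lemma Max_image_ge: "finite I \<Longrightarrow> k \<in> I \<Longrightarrow> f k \<le> (MAX k\<in>I. f k)"
  by simp

context
  fixes I :: "'i set" and M :: "nat \<Rightarrow> 'i \<Rightarrow> 'i \<Rightarrow> ereal"
  assumes I: "finite I" "I \<noteq> {}" and fin: "\<And>t i j. M t i j \<noteq> \<infinity>"
begin

text \<open>In \<open>ereal\<close> the sum of \<infinity> and -\<infinity> is \<infinity>.
  Excluding \<infinity> makes -\<infinity> absorbing, as max-plus arithmetic requires.\<close>

lemma mp_prod_less_PInf: "mp_prod I M n i j \<noteq> \<infinity>"
proof (induction n arbitrary: i)
  case 0 show ?case by (simp add: mp_one_def)
next
  case (Suc n)
  obtain k where "mp_prod I M (Suc n) i j = M n i k + mp_prod I M n k j"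
    using Max_image_attained[OF I, of "\<lambda>k. M n i k + mp_prod I M n k j"] by (auto simp: mp_times_def)
  then show ?case using Suc fin by simp
qed

lemma mp_prod_Suc_ge: "k \<in> I \<Longrightarrow> M n i k + mp_prod I M n k j \<le> mp_prod I M (Suc n) i j"
  using I by (simp add: mp_times_def)

lemma mp_prod_Suc_attained:
  obtains k where "k \<in> I" "mp_prod I M (Suc n) i j = M n i k + mp_prod I M n k j"
  using Max_image_attained[OF I, of "\<lambda>k. M n i k + mp_prod I M n k j"] by (auto simp: mp_times_def)

end

text \<open>An entry is the maximal weight of a walk from \<open>i\<close> to \<open>j\<close>;
  forcing the walk through \<open>k\<close> at time \<open>n\<close> can only lower it.\<close>

lemma mp_prod_add_ge:
  assumes I: "finite I" "I \<noteq> {}" and fin: "\<And>t i j. M t i j \<noteq> \<infinity>" and k: "k \<in> I"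
  shows "mp_prod I (\<lambda>t. M (t + n)) m i k + mp_prod I M n k j \<le> mp_prod I M (m + n) i j"
proof (induction m arbitrary: i)
  case 0
  have "mp_prod I M n k j \<noteq> \<infinity>" using I fin by (rule mp_prod_less_PInf)
  then show ?case by (cases "mp_prod I M n k j") (auto simp: mp_one_def)
next
  case (Suc m)
  obtain l where l: "l \<in> I" "mp_prod I (\<lambda>t. M (t + n)) (Suc m) i k
      = M (m + n) i l + mp_prod I (\<lambda>t. M (t + n)) m l k"
    using mp_prod_Suc_attained[OF I, of "\<lambda>t. M (t + n)"] fin by metis
  have "mp_prod I (\<lambda>t. M (t + n)) (Suc m) i k + mp_prod I M n k j
      = M (m + n) i l + (mp_prod I (\<lambda>t. M (t + n)) m l k + mp_prod I M n k j)"
    by (simp only: l add.assoc)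
  also have "\<dots> \<le> M (m + n) i l + mp_prod I M (m + n) l j" by (intro add_left_mono Suc)
  also have "\<dots> \<le> mp_prod I M (Suc m + n) i j"
    using mp_prod_Suc_ge[of I M l "m + n" i j] I fin l(1) by simp
  finally show ?case .
qed

text \<open>The maximising walk is at some node at time \<open>n\<close>. For \<open>m = 0\<close>
  that node is \<open>i\<close> itself, whence the hypothesis on \<open>i\<close>.\<close>

lemma mp_prod_add_split:
  assumes I: "finite I" "I \<noteq> {}" and fin: "\<And>t i j. M t i j \<noteq> \<infinity>" and i: "i \<in> I"
  shows "\<exists>k\<in>I. mp_prod I M (m + n) i j \<le> mp_prod I (\<lambda>t. M (t + n)) m i k + mp_prod I M n k j"
  using i
proof (induction m arbitrary: i)
  case 0
  then show ?case by (intro bexI[of _ i]) (auto simp: mp_one_def)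
next
  case (Suc m)
  obtain l where l: "l \<in> I" "mp_prod I M (Suc (m + n)) i j = M (m + n) i l + mp_prod I M (m + n) l j"
    using mp_prod_Suc_attained[of I M "m + n" i j] I fin by blast
  obtain k where k: "k \<in> I"
      "mp_prod I M (m + n) l j \<le> mp_prod I (\<lambda>t. M (t + n)) m l k + mp_prod I M n k j"
    using Suc.IH[OF l(1)] by blast
  have "mp_prod I M (Suc m + n) i j
      \<le> M (m + n) i l + (mp_prod I (\<lambda>t. M (t + n)) m l k + mp_prod I M n k j)"
    using l(2) add_left_mono[OF k(2), of "M (m + n) i l"] by simp
  also have "\<dots> = (M (m + n) i l + mp_prod I (\<lambda>t. M (t + n)) m l k) + mp_prod I M n k j"
    by (simp only: add.assoc)
  also have "\<dots> \<le> mp_prod I (\<lambda>t. M (t + n)) (Suc m) i k + mp_prod I M n k j"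
    using mp_prod_Suc_ge[OF I, of "\<lambda>t. M (t + n)" l m i k] fin l(1) by (intro add_right_mono) auto
  finally show ?case using k(1) by blast
qed

lemma mp_prod_mono_index:
  assumes "I \<noteq> {}" "I \<subseteq> J" "finite J"
  shows "mp_prod I M n i j \<le> mp_prod J M n i j"
proof (induction n arbitrary: i)
  case (Suc n)
  have "(MAX k\<in>I. M n i k + mp_prod I M n k j) \<le> (MAX k\<in>J. M n i k + mp_prod J M n k j)"
  proof (rule Max.boundedI)
    fix y assume "y \<in> (\<lambda>k. M n i k + mp_prod I M n k j) ` I"
    then obtain k where k: "k \<in> I" "y = M n i k + mp_prod I M n k j" by blast
    have "y \<le> M n i k + mp_prod J M n k j" using k Suc by (auto intro: add_left_mono)
    also have "\<dots> \<le> (MAX k\<in>J. M n i k + mp_prod J M n k j)" using k assms by (intro Max_image_ge) auto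
    finally show "y \<le> (MAX k\<in>J. M n i k + mp_prod J M n k j)" .
  qed (use assms finite_subset in auto)
  then show ?case by (simp add: mp_times_def)
qed simp


section \<open>Products of an integrable random matrix\<close>

text \<open>A dichotomy without exceptional sets. The Boolean says which case holds and behaves like
  a graph relation: sums of entries give conjunctions, maxima give disjunctions.\<close>

definition (in prob_space) integrable_or_minf :: "bool \<Rightarrow> ('a \<Rightarrow> ereal) \<Rightarrow> bool" where
  "integrable_or_minf b f \<longleftrightarrow>
     (if b then \<exists>h. integrable M h \<and> (\<forall>\<omega>. f \<omega> = ereal (h \<omega>)) else (\<forall>\<omega>. f \<omega> = - \<infinity>))"

context prob_space
begin

lemma integrable_or_minf_add:
  assumes "integrable_or_minf b f" "integrable_or_minf b' f'"
  shows "integrable_or_minf (b \<and> b') (\<lambda>\<omega>. f \<omega> + f' \<omega>)"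
proof (cases "b \<and> b'")
  case True
  then obtain h h' where "integrable M h" "\<forall>\<omega>. f \<omega> = ereal (h \<omega>)"
      "integrable M h'" "\<forall>\<omega>. f' \<omega> = ereal (h' \<omega>)"
    using assms by (auto simp: integrable_or_minf_def)
  then show ?thesis using True
    by (auto simp: integrable_or_minf_def intro!: exI[of _ "\<lambda>\<omega>. h \<omega> + h' \<omega>"])
next
  case False
  then show ?thesis using assms by (auto simp: integrable_or_minf_def split: if_splits)
qed

lemma integrable_or_minf_max:
  assumes "integrable_or_minf b f" "integrable_or_minf b' f'"
  shows "integrable_or_minf (b \<or> b') (\<lambda>\<omega>. max (f \<omega>) (f' \<omega>))"
proof (cases "b \<and> b'")
  case True
  then obtain h h' where "integrable M h" "\<forall>\<omega>. f \<omega> = ereal (h \<omega>)"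
      "integrable M h'" "\<forall>\<omega>. f' \<omega> = ereal (h' \<omega>)"
    using assms by (auto simp: integrable_or_minf_def)
  then show ?thesis using True
    by (auto simp: integrable_or_minf_def intro!: exI[of _ "\<lambda>\<omega>. max (h \<omega>) (h' \<omega>)"])
next
  case False
  then show ?thesis using assms by (cases b; cases b') (auto simp: integrable_or_minf_def)
qed

lemma integrable_or_minf_Max:
  assumes "finite I" "I \<noteq> {}" "\<And>k. k \<in> I \<Longrightarrow> integrable_or_minf (b k) (f k)"
  shows "integrable_or_minf (\<exists>k\<in>I. b k) (\<lambda>\<omega>. MAX k\<in>I. f k \<omega>)"
  using assms
proof (induction I rule: finite_ne_induct)
  case (singleton x)
  then show ?case by simp
next
  case (insert x F)
  then have "integrable_or_minf (b x \<or> (\<exists>k\<in>F. b k)) (\<lambda>\<omega>. max (f x \<omega>) (MAX k\<in>F. f k \<omega>))"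
    by (intro integrable_or_minf_max) auto
  then show ?case using insert.hyps by simp
qed

end

text \<open>The values of \<open>a\<close> outside \<open>E\<close> do not matter: the matrix entry there is \<open>-\<infinity>\<close>.\<close>

locale mp_system = measure_preserving_system P \<theta> for P :: "'w measure" and \<theta> +
  fixes E :: "('d::finite \<times> 'd) set" and a :: "'d \<Rightarrow> 'd \<Rightarrow> 'w \<Rightarrow> real"
  assumes a_integrable: "\<And>i j. integrable P (a i j)"
    and ergodic_powers: "\<And>k. k \<in> {1..CARD('d)} \<Longrightarrow> ergodic_map P (\<theta> ^^ k)"
begin

lemma ergodic_system_power: "k \<in> {1..CARD('d)} \<Longrightarrow> ergodic_system P (\<theta> ^^ k)"
  using ergodic_powers measure_preserving_funpow
  by (intro ergodic_system.intro measure_preserving_system.intro prob_space_axioms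
      ergodic_system_axioms.intro measure_preserving_system_axioms.intro) auto

sublocale ergodic_system P \<theta>
  using ergodic_system_power[of 1] by (simp add: Suc_le_eq)

text \<open>A version of the random matrix whose pattern of -\<infinity> does not depend on
  \<open>\<omega>\<close>, so that finiteness of a product entry is a question about walks
  only.\<close>

definition mat :: "'w \<Rightarrow> 'd \<Rightarrow> 'd \<Rightarrow> ereal" where
  "mat \<omega> i j = (if (i, j) \<in> E then ereal (a i j \<omega>) else - \<infinity>)"

definition S :: "'d set \<Rightarrow> nat \<Rightarrow> 'w \<Rightarrow> 'd \<Rightarrow> 'd \<Rightarrow> ereal" where
  "S I n \<omega> = mp_prod I (\<lambda>t. mat ((\<theta> ^^ t) \<omega>)) n"

abbreviation E_on :: "'d set \<Rightarrow> ('d \<times> 'd) set" where "E_on I \<equiv> E \<inter> I \<times> I"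

definition weight :: "'w \<Rightarrow> real" where
  "weight \<omega> = (\<Sum>i\<in>UNIV. \<Sum>j\<in>UNIV. \<bar>a i j \<omega>\<bar>)"

lemma funpow_shift: "(\<theta> ^^ t) ((\<theta> ^^ s) \<omega>) = (\<theta> ^^ (t + s)) \<omega>"
  by (simp add: funpow_add)

lemma mat_neq_PInf [simp]: "mat \<omega> i j \<noteq> \<infinity>"
  by (simp add: mat_def)

lemma integrable_weight: "integrable P weight"
  unfolding weight_def[abs_def] using a_integrable by (intro Bochner_Integration.integrable_sum) auto

lemma weight_nonneg: "weight \<omega> \<ge> 0"
  by (simp add: weight_def sum_nonneg)

lemma abs_a_le_weight: "\<bar>a i j \<omega>\<bar> \<le> weight \<omega>"
proof -
  have "\<bar>a i j \<omega>\<bar> \<le> (\<Sum>j\<in>UNIV. \<bar>a i j \<omega>\<bar>)" by (intro member_le_sum) auto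
  also have "\<dots> \<le> weight \<omega>"
    unfolding weight_def
    by (rule member_le_sum[of i UNIV "\<lambda>i. \<Sum>j\<in>UNIV. \<bar>a i j \<omega>\<bar>"]) (auto intro: sum_nonneg)
  finally show ?thesis .
qed

lemma mat_le_weight: "mat \<omega> i j \<le> ereal (weight \<omega>)"
  using abs_a_le_weight[of i j \<omega>] by (auto simp: mat_def)

lemma S_0: "S I 0 \<omega> i j = (if i = j then 0 else - \<infinity>)"
  by (simp add: S_def mp_one_def)

context
  fixes I :: "'d set" assumes I: "I \<noteq> {}"
begin

lemma S_Suc: "S I (Suc n) \<omega> i j = (MAX k\<in>I. mat ((\<theta> ^^ n) \<omega>) i k + S I n \<omega> k j)"
  by (simp add: S_def mp_times_def)

lemma S_add_ge:
  "k \<in> I \<Longrightarrow> S I m ((\<theta> ^^ n) \<omega>) i k + S I n \<omega> k j \<le> S I (m + n) \<omega> i j"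
  using mp_prod_add_ge[of I "\<lambda>t. mat ((\<theta> ^^ t) \<omega>)" k n m i j] I
  by (simp add: S_def funpow_shift)

lemma S_add_split:
  "i \<in> I \<Longrightarrow> \<exists>k\<in>I. S I (m + n) \<omega> i j \<le> S I m ((\<theta> ^^ n) \<omega>) i k + S I n \<omega> k j"
  using mp_prod_add_split[of I "\<lambda>t. mat ((\<theta> ^^ t) \<omega>)" i m n j] I
  by (simp add: S_def funpow_shift)

lemma S_neq_PInf: "S I n \<omega> i j \<noteq> \<infinity>"
  unfolding S_def using I by (intro mp_prod_less_PInf) auto

lemma S_le_birkhoff_sum: "S I n \<omega> i j \<le> ereal (birkhoff_sum \<theta> weight n \<omega>)"
proof (induction n arbitrary: i)
  case 0 show ?case by (simp add: S_0)
next
  case (Suc n)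
  obtain k where "S I (Suc n) \<omega> i j = mat ((\<theta> ^^ n) \<omega>) i k + S I n \<omega> k j"
    unfolding S_Suc using Max_image_attained[of I "\<lambda>k. mat ((\<theta> ^^ n) \<omega>) i k + S I n \<omega> k j"] I by auto
  also have "\<dots> \<le> ereal (weight ((\<theta> ^^ n) \<omega>)) + ereal (birkhoff_sum \<theta> weight n \<omega>)"
    by (intro add_mono mat_le_weight Suc)
  finally show ?case by (simp add: birkhoff_sum_Suc add.commute)
qed

text \<open>Relational powers split off the last arc, products of matrices the first one; this
  aligns the two recursions.\<close>

lemma relpow_E_on_Suc_iff:
  assumes "i \<in> I" "j \<in> I"
  shows "(i, j) \<in> E_on I ^^ Suc n \<longleftrightarrow> (\<exists>k\<in>I. (i, k) \<in> E \<and> (k, j) \<in> E_on I ^^ n)"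
  using assms unfolding relpow.simps relpow_commute[symmetric] by auto

text \<open>The matrix recursion turns into the recursion for walks: the maximum over
  \<open>k\<close> becomes the existence of \<open>k\<close>, the sum becomes an arc followed by a
  walk.\<close>

lemma integrable_or_minf_S:
  assumes "i \<in> I" "j \<in> I"
  shows "integrable_or_minf ((i, j) \<in> E_on I ^^ n) (\<lambda>\<omega>. S I n \<omega> i j)"
  using assms(1)
proof (induction n arbitrary: i)
  case 0
  show ?case by (auto simp: integrable_or_minf_def S_0 zero_ereal_def intro!: exI[of _ "\<lambda>_. 0"])
next
  case (Suc n)
  have entry: "integrable_or_minf ((i, k) \<in> E) (\<lambda>\<omega>. mat ((\<theta> ^^ n) \<omega>) i k)" for k
    using integrable_funpow[OF a_integrable, of i k n]
    by (auto simp: integrable_or_minf_def mat_def)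
  have "integrable_or_minf (\<exists>k\<in>I. (i, k) \<in> E \<and> (k, j) \<in> E_on I ^^ n) (\<lambda>\<omega>. S I (Suc n) \<omega> i j)"
    unfolding S_Suc using I entry Suc.IH
    by (intro integrable_or_minf_Max integrable_or_minf_add) auto
  then show ?case using relpow_E_on_Suc_iff[OF Suc.prems assms(2)] by simp
qed

text \<open>If no walk of length \<open>n\<close> exists, the value is the default 0 of
  \<open>real_of_ereal\<close> and carries no information; therefore the facts below assume a
  walk.\<close>

definition val :: "nat \<Rightarrow> 'd \<Rightarrow> 'd \<Rightarrow> 'w \<Rightarrow> real" where
  "val n i j \<omega> = real_of_ereal (S I n \<omega> i j)"

lemma S_eq_val:
  assumes "i \<in> I" "j \<in> I" "(i, j) \<in> E_on I ^^ n"
  shows "S I n \<omega> i j = ereal (val n i j \<omega>)"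
  using integrable_or_minf_S[OF assms(1,2), of n] assms(3)
  by (auto simp: integrable_or_minf_def val_def)

lemma integrable_val:
  assumes "i \<in> I" "j \<in> I" "(i, j) \<in> E_on I ^^ n"
  shows "integrable P (val n i j)"
proof -
  obtain h where "integrable P h" "\<forall>\<omega>. S I n \<omega> i j = ereal (h \<omega>)"
    using integrable_or_minf_S[OF assms(1,2), of n] assms(3) by (auto simp: integrable_or_minf_def)
  then show ?thesis unfolding val_def[abs_def] by simp
qed

lemma S_eq_minf:
  assumes "i \<in> I" "j \<in> I" "(i, j) \<notin> E_on I ^^ n"
  shows "S I n \<omega> i j = - \<infinity>"
  using integrable_or_minf_S[OF assms(1,2), of n] assms(3) by (auto simp: integrable_or_minf_def)

lemma val_add_ge:
  assumes "i \<in> I" "k \<in> I" "j \<in> I" "(i, k) \<in> E_on I ^^ m" "(k, j) \<in> E_on I ^^ n"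
  shows "val m i k ((\<theta> ^^ n) \<omega>) + val n k j \<omega> \<le> val (m + n) i j \<omega>"
  using S_add_ge[OF assms(2), of m n \<omega> i j] relpow_trans[OF assms(4,5)] assms
  by (simp add: S_eq_val)

lemma val_le_birkhoff_sum:
  assumes "i \<in> I" "j \<in> I" "(i, j) \<in> E_on I ^^ n"
  shows "val n i j \<omega> \<le> birkhoff_sum \<theta> weight n \<omega>"
  using S_le_birkhoff_sum[of n \<omega> i j] S_eq_val[OF assms, of \<omega>] by simp

text \<open>One majorant for all connecting pieces of bounded length, whatever their end nodes;
  along an orbit it is then sublinear.\<close>

lemma val_bounded_by_integrable:
  obtains H where "integrable P H"
    "\<And>r i j \<omega>. r \<le> R \<Longrightarrow> i \<in> I \<Longrightarrow> j \<in> I \<Longrightarrow> (i, j) \<in> E_on I ^^ r \<Longrightarrow> \<bar>val r i j \<omega>\<bar> \<le> H \<omega>"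
proof -
  define Q where "Q = {(r, i, j). r \<le> R \<and> i \<in> I \<and> j \<in> I \<and> (i, j) \<in> E_on I ^^ r}"
  have "Q \<subseteq> {..R} \<times> UNIV" by (auto simp: Q_def)
  then have fin: "finite Q" by (rule finite_subset) simp
  define H where "H \<omega> = (\<Sum>(r, i, j)\<in>Q. \<bar>val r i j \<omega>\<bar>)" for \<omega>
  have "integrable P H"
    unfolding H_def by (intro Bochner_Integration.integrable_sum) (auto simp: Q_def integrable_val)
  moreover have "\<bar>val r i j \<omega>\<bar> \<le> H \<omega>"
    if "r \<le> R" "i \<in> I" "j \<in> I" "(i, j) \<in> E_on I ^^ r" for r i j \<omega>
    unfolding H_def using that fin
      member_le_sum[of "(r, i, j)" Q "\<lambda>(r, i, j). \<bar>val r i j \<omega>\<bar>"] by (auto simp: Q_def)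
  ultimately show ?thesis by (rule that)
qed

end

end


section \<open>The growth rate of a strongly connected component\<close>

locale periodic_component = mp_system P \<theta> E a
  for P :: "'w measure" and \<theta> and E :: "('d::finite \<times> 'd) set" and a +
  fixes c :: "'d set" and g K :: nat
  assumes c_nonempty: "c \<noteq> {}"
    and path: "\<And>i j. i \<in> c \<Longrightarrow> j \<in> c \<Longrightarrow> \<exists>n. (i, j) \<in> E_on c ^^ n"
    and successor: "\<And>i. i \<in> c \<Longrightarrow> \<exists>j\<in>c. (i, j) \<in> E"
    and g: "g \<in> {1..card c}"
    and closed_dvd: "\<And>i n. i \<in> c \<Longrightarrow> (i, i) \<in> E_on c ^^ n \<Longrightarrow> g dvd n"
    and path_multiple: "\<And>i j l m. i \<in> c \<Longrightarrow> j \<in> c \<Longrightarrow> (i, j) \<in> E_on c ^^ (g * l) \<Longrightarrow> m \<ge> K \<Longrightarrow>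
       (i, j) \<in> E_on c ^^ (g * m)"
begin

abbreviation "h \<equiv> val c"
abbreviation "Ec \<equiv> E_on c"

section \<open>Mean weights of loops and their common rate\<close>

definition mean_val :: "nat \<Rightarrow> 'd \<Rightarrow> 'd \<Rightarrow> real" where
  "mean_val n i j = integral\<^sup>L P (h n i j)"

lemma g_pos: "g > 0" "real g > 0" "real g \<ge> 1"
  using g by auto

lemma loop_path: "i \<in> c \<Longrightarrow> m \<ge> K \<Longrightarrow> (i, i) \<in> Ec ^^ (g * m)"
  using path_multiple[of i i 0 m] by simp

lemma path_of_length: "i \<in> c \<Longrightarrow> \<exists>j\<in>c. (i, j) \<in> Ec ^^ n"
proof (induction n)
  case 0 then show ?case by auto
next
  case (Suc n)
  then obtain j where "j \<in> c" "(i, j) \<in> Ec ^^ n" by blast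
  then show ?case using successor[of j] by auto
qed

lemma mean_val_add:
  assumes "i \<in> c" "k \<in> c" "j \<in> c" "(i, k) \<in> Ec ^^ m" "(k, j) \<in> Ec ^^ n"
  shows "mean_val m i k + mean_val n k j \<le> mean_val (m + n) i j"
proof -
  have int: "integrable P (h m i k)" "integrable P (h n k j)" "integrable P (h (m + n) i j)"
    using assms integrable_val[OF c_nonempty] relpow_trans[OF assms(4,5)] by auto
  have "mean_val m i k + mean_val n k j = (\<integral>\<omega>. h m i k ((\<theta> ^^ n) \<omega>) + h n k j \<omega> \<partial>P)"
    unfolding mean_val_def using int integrable_funpow[OF int(1), of n] integral_funpow[OF int(1), of n] by simp
  also have "\<dots> \<le> mean_val (m + n) i j"
    unfolding mean_val_def using int integrable_funpow[OF int(1), of n] val_add_ge[OF c_nonempty assms]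
    by (intro integral_mono) auto
  finally show ?thesis .
qed

lemma mean_val_le_weight:
  assumes "i \<in> c" "j \<in> c" "(i, j) \<in> Ec ^^ n"
  shows "mean_val n i j \<le> real n * integral\<^sup>L P weight"
  unfolding mean_val_def integral_birkhoff_sum[OF integrable_weight, symmetric]
  using integrable_val[OF c_nonempty assms] integrable_birkhoff_sum[OF integrable_weight]
    val_le_birkhoff_sum[OF c_nonempty assms] by (intro integral_mono) auto

lemma mean_val_iterate:
  assumes "i \<in> c" "(i, i) \<in> Ec ^^ n"
  shows "(i, i) \<in> Ec ^^ (q * n) \<and> real q * mean_val n i i \<le> mean_val (q * n) i i"
proof (induction q)
  case 0
  have "h 0 i i = (\<lambda>_. 0)" by (auto simp: val_def[OF c_nonempty] S_0)
  then show ?case by (simp add: mean_val_def)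
next
  case (Suc q)
  then have "mean_val n i i + mean_val (q * n) i i \<le> mean_val (n + q * n) i i" using assms by (intro mean_val_add) auto
  moreover have "(i, i) \<in> Ec ^^ (n + q * n)" using relpow_trans[OF assms(2), of i "q * n"] Suc by blast
  ultimately show ?case using Suc by (simp add: algebra_simps)
qed

text \<open>By superadditivity this is the quantity to which the mean rates would tend by Fekete's
  lemma; the supremum is easier to use. Beyond \<open>K\<close> the loops exist and their length is
  positive.\<close>

definition loop_rate :: "'d \<Rightarrow> real" where
  "loop_rate i = (SUP m\<in>{Suc K..}. mean_val (g * m) i i / real (g * m))"

lemma loop_rate_bdd:
  assumes "i \<in> c"
  shows "bdd_above ((\<lambda>m. mean_val (g * m) i i / real (g * m)) ` {Suc K..})"
proof (rule bdd_aboveI2)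
  fix m assume "m \<in> {Suc K..}"
  then have "m > K" by auto
  then have "mean_val (g * m) i i \<le> real (g * m) * integral\<^sup>L P weight" "real (g * m) > 0"
    using mean_val_le_weight[OF assms assms loop_path[OF assms, of m]] g_pos by auto
  then show "mean_val (g * m) i i / real (g * m) \<le> integral\<^sup>L P weight" by (simp add: field_simps)
qed

lemma mean_val_le_loop_rate:
  assumes "i \<in> c" "m > K"
  shows "mean_val (g * m) i i \<le> loop_rate i * real (g * m)"
proof -
  have "mean_val (g * m) i i / real (g * m) \<le> loop_rate i"
    unfolding loop_rate_def using assms by (intro cSUP_upper loop_rate_bdd) auto
  moreover have "real (g * m) > 0" using assms g_pos by simp
  ultimately show ?thesis by (simp add: pos_divide_le_eq)
qed

text \<open>A loop at \<open>j\<close> whose mean exceeds the rate at \<open>i\<close> by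
  \<open>D\<close> could be repeated \<open>q\<close> times between fixed walks from
  \<open>i\<close> to \<open>j\<close> and back. The gain \<open>q * D\<close> outgrows the fixed
  cost \<open>B\<close> of these walks.\<close>

lemma mean_val_le_loop_rate_other:
  assumes ij: "i \<in> c" "j \<in> c" and m: "m > K"
  shows "mean_val (g * m) j j \<le> loop_rate i * real (g * m)"
proof (rule ccontr)
  define D where "D = mean_val (g * m) j j - loop_rate i * real (g * m)"
  assume "\<not> ?thesis"
  then have D: "D > 0" by (simp add: D_def)
  obtain k where k: "(i, j) \<in> Ec ^^ k" using path ij by blast
  obtain k' where k': "(j, i) \<in> Ec ^^ k'" using path ij by blast
  obtain u where u: "k + k' = g * u" using closed_dvd[OF ij(1) relpow_trans[OF k k']] by blast
  define B where "B = loop_rate i * real (g * u) - mean_val k i j - mean_val k' j i"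
  obtain q where q: "B < real q * D" using reals_Archimedean3[OF D] by blast
  have loop: "(j, j) \<in> Ec ^^ (g * m)" using loop_path ij m by simp
  \<comment> \<open>\<open>Suc q\<close> rather than \<open>q\<close>: one loop for certain keeps
    the total length above \<open>g * K\<close>, where \<open>loop_rate i\<close> is a
    bound.\<close>
  note it = mean_val_iterate[OF ij(2) loop, of "Suc q"]
  note k_it = relpow_trans[OF k conjunct1[OF it]]
  have "mean_val k i j + real (Suc q) * mean_val (g * m) j j + mean_val k' j i
      \<le> mean_val k i j + mean_val (Suc q * (g * m)) j j + mean_val k' j i" using it by simp
  also have "\<dots> \<le> mean_val (k + Suc q * (g * m)) i j + mean_val k' j i"
    using mean_val_add[OF ij(1) ij(2) ij(2) k, of "Suc q * (g * m)"] it by simp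
  also have "\<dots> \<le> mean_val (k + Suc q * (g * m) + k') i i"
    by (rule mean_val_add[OF ij(1) ij(2) ij(1) k_it k'])
  also have "k + Suc q * (g * m) + k' = g * (u + Suc q * m)" using u by (simp add: algebra_simps)
  also have "mean_val (g * (u + Suc q * m)) i i \<le> loop_rate i * real (g * (u + Suc q * m))"
    using m ij by (intro mean_val_le_loop_rate) auto
  finally have "real (Suc q) * D \<le> B" by (simp add: D_def B_def algebra_simps)
  moreover have "real q * D \<le> real (Suc q) * D" using D by (simp add: algebra_simps)
  ultimately show False using q by linarith
qed

lemma loop_rate_eq:
  assumes "i \<in> c" "j \<in> c"
  shows "loop_rate i = loop_rate j"
proof -
  have "loop_rate j \<le> loop_rate i" if "i \<in> c" "j \<in> c" for i j
  proof -
    have "mean_val (g * m) j j / real (g * m) \<le> loop_rate i" if "m > K" for m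
    proof -
      have "real (g * m) > 0" using that g_pos by simp
      then show ?thesis using mean_val_le_loop_rate_other[OF \<open>i \<in> c\<close> \<open>j \<in> c\<close> that]
        by (simp add: pos_divide_le_eq)
    qed
    then show ?thesis unfolding loop_rate_def[of j] by (intro cSUP_least) auto
  qed
  then show ?thesis using assms by (meson order_antisym)
qed

definition rate :: real where "rate = loop_rate (SOME i. i \<in> c)"

lemma loop_rate_eq_rate: "i \<in> c \<Longrightarrow> loop_rate i = rate"
  unfolding rate_def using c_nonempty by (intro loop_rate_eq) (auto simp: some_in_eq)

lemma mean_val_le_rate: "i \<in> c \<Longrightarrow> m > K \<Longrightarrow> mean_val (g * m) i i \<le> rate * real (g * m)"
  using mean_val_le_loop_rate loop_rate_eq_rate by simp

lemma rate_approx: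
  assumes "i \<in> c" "\<delta> > 0"
  obtains m where "m > K" "(rate - \<delta>) * real (g * m) \<le> mean_val (g * m) i i"
proof -
  have "rate - \<delta> < loop_rate i" using loop_rate_eq_rate assms by simp
  then obtain m where m: "m \<in> {Suc K..}" "rate - \<delta> < mean_val (g * m) i i / real (g * m)"
    unfolding loop_rate_def using less_cSUP_iff[OF _ loop_rate_bdd[OF assms(1)]] by auto
  then have "real (g * m) > 0" using g_pos by simp
  then have "(rate - \<delta>) * real (g * m) \<le> mean_val (g * m) i i" using m by (simp add: pos_less_divide_eq)
  moreover have "m > K" using m by auto
  ultimately show ?thesis by (rule that[rotated])
qed

section \<open>Lower bound for a component\<close>

lemma funpow_g: "((\<theta> ^^ g) ^^ n) \<omega> = (\<theta> ^^ (g * n)) \<omega>"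
  by (simp add: funpow_mult)

lemma ergodic_system_g: "ergodic_system P (\<theta> ^^ g)"
proof (rule ergodic_system_power)
  have "card c \<le> CARD('d)" by (intro card_mono) auto
  then show "g \<in> {1..CARD('d)}" using g by auto
qed

text \<open>Minus a diagonal entry is subadditive over the ergodic map \<open>\<theta> ^^ g\<close>.
  A block whose mean nearly attains the supremum is chosen for each of countably many
  tolerances.\<close>

lemma AE_loop_lower:
  assumes j: "j \<in> c"
  shows "AE \<omega> in P. \<forall>\<delta>>0. \<exists>C. \<forall>m>K. (rate - \<delta>) * real (g * m) - C \<le> h (g * m) j j \<omega>"
proof -
  interpret T: ergodic_system P "\<theta> ^^ g" by (rule ergodic_system_g)
  have "AE \<omega> in P. \<forall>k::nat. \<forall>\<epsilon>>0. \<exists>C. \<forall>s m. m \<ge> Suc K \<longrightarrow>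
      - h (g * m) j j (((\<theta> ^^ g) ^^ s) \<omega>)
        \<le> (- (rate - inverse (real (Suc k))) * real g) * real m + \<epsilon> * real (s + m) + C"
  proof (subst AE_all_countable, rule allI)
    fix k :: nat
    obtain N where N: "N > K" "(rate - inverse (real (Suc k))) * real (g * N) \<le> mean_val (g * N) j j"
      using rate_approx[OF j, of "inverse (real (Suc k))"] by auto
    show "AE \<omega> in P. \<forall>\<epsilon>>0. \<exists>C. \<forall>s m. m \<ge> Suc K \<longrightarrow>
      - h (g * m) j j (((\<theta> ^^ g) ^^ s) \<omega>)
        \<le> (- (rate - inverse (real (Suc k))) * real g) * real m + \<epsilon> * real (s + m) + C"
    proof (rule T.AE_subadditive_upper[where N = N and f = "\<lambda>m \<omega>. - h (g * m) j j \<omega>"])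
      show "integrable P (\<lambda>\<omega>. - h (g * m) j j \<omega>)" if "m \<ge> Suc K" for m
        using integrable_val[OF c_nonempty j j loop_path[OF j]] that by simp
      show "- h (g * (m + n)) j j \<omega> \<le> - h (g * m) j j (((\<theta> ^^ g) ^^ n) \<omega>) + - h (g * n) j j \<omega>"
        if "m \<ge> Suc K" "n \<ge> Suc K" for m n \<omega>
        using val_add_ge[OF c_nonempty j j j loop_path[OF j] loop_path[OF j], of m n \<omega>] that
        by (simp add: funpow_g distrib_left)
      show "(\<integral>\<omega>. - h (g * N) j j \<omega> \<partial>P) \<le> - (rate - inverse (real (Suc k))) * real g * real N"
        using N by (simp add: mean_val_def algebra_simps)
    qed (use N in auto)
  qed
  then show ?thesis
  proof eventually_elim
    case (elim \<omega>)
    show ?case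
    proof (intro allI impI)
      fix \<delta> :: real assume \<delta>: "\<delta> > 0"
      then obtain k where k: "inverse (real (Suc k)) < \<delta> / 2"
        using reals_Archimedean[of "\<delta> / 2"] by auto
      have "\<delta> / 2 > 0" using \<delta> by simp
      then obtain C where C: "\<forall>s m. m \<ge> Suc K \<longrightarrow> - h (g * m) j j (((\<theta> ^^ g) ^^ s) \<omega>)
        \<le> (- (rate - inverse (real (Suc k))) * real g) * real m + \<delta> / 2 * real (s + m) + C"
        using elim by blast
      have "(rate - \<delta>) * real (g * m) - C \<le> h (g * m) j j \<omega>" if "m > K" for m
      proof -
        have "- h (g * m) j j \<omega> \<le> (- (rate - inverse (real (Suc k))) * real g) * real m + \<delta> / 2 * real m + C"
          using C[rule_format, of m 0] that by simp
        moreover have "inverse (real (Suc k)) * (real g * real m) \<le> \<delta> / 2 * (real g * real m)"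
          using k by (intro mult_right_mono) auto
        moreover have "\<delta> / 2 * real m \<le> \<delta> / 2 * (real g * real m)"
          using \<delta> g_pos(3) mult_right_mono[of 1 "real g" "real m"] by (intro mult_left_mono) auto
        ultimately show ?thesis by (simp add: algebra_simps)
      qed
      then show "\<exists>C. \<forall>m>K. (rate - \<delta>) * real (g * m) - C \<le> h (g * m) j j \<omega>" by blast
    qed
  qed
qed

text \<open>With \<open>n = r + g * m\<close>, a loop at \<open>j\<close> fills the first
  \<open>g * m\<close> time steps and a short walk from \<open>i\<close> to \<open>j\<close> the
  last \<open>r\<close>. The end node \<open>j\<close> cannot be prescribed, because it depends on
  the residue \<open>r\<close>.\<close>

lemma AE_lower:
  "AE \<omega> in P. \<forall>\<delta>>0. \<forall>\<^sub>F n in sequentially. \<forall>i\<in>c. \<exists>j\<in>c. ereal ((rate - \<delta>) * real n) \<le> S c n \<omega> i j"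
proof -
  have "AE \<omega> in P. \<forall>j\<in>c. \<forall>\<delta>>0. \<exists>C. \<forall>m>K. (rate - \<delta>) * real (g * m) - C \<le> h (g * m) j j \<omega>"
    by (intro AE_ball_countable' AE_loop_lower) (auto intro: countable_finite)
  moreover obtain H where H: "integrable P H"
    "\<And>r i j \<omega>. r \<le> g \<Longrightarrow> i \<in> c \<Longrightarrow> j \<in> c \<Longrightarrow> (i, j) \<in> Ec ^^ r \<Longrightarrow> \<bar>h r i j \<omega>\<bar> \<le> H \<omega>"
    using val_bounded_by_integrable[OF c_nonempty, of g] by blast
  note AE_sublinear_orbit[OF H(1)]
  ultimately show ?thesis
  proof eventually_elim
    case (elim \<omega>)
    show ?case
    proof (intro allI impI)
      fix \<delta> :: real assume \<delta>: "\<delta> > 0"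
      then have \<delta>3: "\<delta> / 3 > 0" by simp
      have "\<forall>j\<in>c. \<exists>C. \<forall>m>K. (rate - \<delta> / 3) * real (g * m) - C \<le> h (g * m) j j \<omega>"
        using elim(1) \<delta>3 by blast
      then obtain C where C: "\<And>j m. j \<in> c \<Longrightarrow> m > K \<Longrightarrow>
          (rate - \<delta> / 3) * real (g * m) - C j \<le> h (g * m) j j \<omega>" by metis
      define C' where "C' = (\<Sum>j\<in>c. \<bar>C j\<bar>)"
      have C': "C j \<le> C'" if "j \<in> c" for j
      proof -
        have "\<bar>C j\<bar> \<le> C'" unfolding C'_def using that by (intro member_le_sum) auto
        then show ?thesis by linarith
      qed
      obtain D where D: "\<And>n. \<bar>H ((\<theta> ^^ n) \<omega>)\<bar> \<le> \<delta> / 3 * real n + D"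
        using sublinearD[OF elim(2) \<delta>3] by blast
      \<comment> \<open>Collects the growth missed in the last \<open>r < g\<close> steps, the
        constant of the sublinear bound for \<open>H\<close> and the loop constants; the last third
        of \<delta> absorbs it. The absolute value is there since the rate may have either
        sign.\<close>
      define B where "B = \<bar>rate - 2 * \<delta> / 3\<bar> * real g + D + C'"
      obtain n0 :: nat where n0: "B / (\<delta> / 3) < real n0" using reals_Archimedean2 by blast
      have "\<exists>j\<in>c. ereal ((rate - \<delta>) * real n) \<le> S c n \<omega> i j"
        if n: "n \<ge> n0 + g * Suc K" and i: "i \<in> c" for n i
      proof -
        define m r where "m = n div g" and "r = n mod g"
        have nmr: "n = r + g * m" by (simp add: m_def r_def)
        have r: "r < g" using g_pos by (simp add: r_def)
        have "g * Suc K div g \<le> n div g" using n by (intro div_le_mono) auto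
        then have m: "m > K" using g_pos by (simp add: m_def)
        obtain j where j: "j \<in> c" "(i, j) \<in> Ec ^^ r" using path_of_length[OF i] by blast
        have jj: "(j, j) \<in> Ec ^^ (g * m)" using loop_path j m by simp
        have "h r i j ((\<theta> ^^ (g * m)) \<omega>) + h (g * m) j j \<omega> \<le> h n i j \<omega>"
          using val_add_ge[OF c_nonempty i j(1) j(1) j(2) jj] by (simp add: nmr)
        moreover have "- (\<delta> / 3 * real (g * m) + D) \<le> h r i j ((\<theta> ^^ (g * m)) \<omega>)"
          using H(2)[OF _ i j, of "(\<theta> ^^ (g * m)) \<omega>"] r D[of "g * m"] by linarith
        moreover have "(rate - \<delta> / 3) * real (g * m) - C' \<le> h (g * m) j j \<omega>"
          using C[OF j(1) m] C'[OF j(1)] by linarith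
        ultimately have "(rate - 2 * \<delta> / 3) * real (g * m) - D - C' \<le> h n i j \<omega>"
          by (simp add: algebra_simps)
        moreover have "(rate - 2 * \<delta> / 3) * real (g * m)
            \<ge> (rate - 2 * \<delta> / 3) * real n - \<bar>rate - 2 * \<delta> / 3\<bar> * real g"
        proof -
          have "(rate - 2 * \<delta> / 3) * real r \<le> \<bar>rate - 2 * \<delta> / 3\<bar> * real g"
            using r by (intro mult_mono) auto
          moreover have "(rate - 2 * \<delta> / 3) * real n
              = (rate - 2 * \<delta> / 3) * real r + (rate - 2 * \<delta> / 3) * real (g * m)"
            by (simp only: nmr of_nat_add distrib_left)
          ultimately show ?thesis by linarith
        qed
        moreover have "B \<le> \<delta> / 3 * real n"
        proof -
          have "B / (\<delta> / 3) \<le> real n" using n0 n by simp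
          then show ?thesis using \<delta> by (simp add: field_simps)
        qed
        ultimately have "(rate - \<delta>) * real n \<le> h n i j \<omega>"
          unfolding B_def by (simp add: algebra_simps)
        moreover have "S c n \<omega> i j = ereal (h n i j \<omega>)"
          using S_eq_val[OF c_nonempty i j(1) relpow_trans[OF j(2) jj]] by (simp add: nmr)
        ultimately show ?thesis using j(1) by (intro bexI[of _ j]) simp_all
      qed
      then show "\<forall>\<^sub>F n in sequentially. \<forall>i\<in>c. \<exists>j\<in>c. ereal ((rate - \<delta>) * real n) \<le> S c n \<omega> i j"
        unfolding eventually_sequentially by blast
    qed
  qed
qed

section \<open>Cyclic classes and the upper bound for a component\<close>

definition cyclic_class :: "'d \<Rightarrow> 'd set" where
  "cyclic_class i = {j \<in> c. \<exists>l. (i, j) \<in> Ec ^^ (g * l)}"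

text \<open>A return from \<open>j\<close> to \<open>i\<close> closes a loop, so its length is a
  multiple of \<open>g\<close>. Hence within a class all entries of products of length
  \<open>g * m\<close>, \<open>m \<ge> K\<close>, are finite.\<close>

lemma cyclic_class_path:
  assumes "i \<in> c" "j \<in> cyclic_class i" "k \<in> cyclic_class i" "m \<ge> K"
  shows "(j, k) \<in> Ec ^^ (g * m)"
proof -
  from assms obtain l l' where l: "(i, j) \<in> Ec ^^ (g * l)" "(i, k) \<in> Ec ^^ (g * l')" "j \<in> c" "k \<in> c"
    by (auto simp: cyclic_class_def)
  obtain n where n: "(j, i) \<in> Ec ^^ n" using path l assms by blast
  have "g dvd g * l + n" using closed_dvd[OF assms(1) relpow_trans[OF l(1) n]] .
  then have "g dvd n" by (simp add: dvd_add_right_iff)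
  then obtain u where "n = g * u" by blast
  then have "(j, k) \<in> Ec ^^ (g * (u + l'))" using relpow_trans[OF n l(2)] by (simp add: distrib_left)
  then show ?thesis using path_multiple assms(4) l by blast
qed

text \<open>A walk inside the component between nodes of the class is again in the class after every
  multiple of \<open>g\<close> steps. This makes the maximum over the class real-valued, integrable
  and subadditive over \<open>\<theta> ^^ g\<close>.\<close>

lemma AE_class_upper:
  assumes i: "i \<in> c"
  shows "AE \<omega> in P. \<forall>\<delta>>0. \<exists>C. \<forall>s m. \<forall>j\<in>cyclic_class i. \<forall>k\<in>cyclic_class i. m > K \<longrightarrow>
    h (g * m) j k ((\<theta> ^^ (g * s)) \<omega>) \<le> rate * real (g * m) + \<delta> * real (s + m) + C"
proof -
  interpret T: ergodic_system P "\<theta> ^^ g" by (rule ergodic_system_g)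
  let ?C = "cyclic_class i"
  have i_in: "i \<in> ?C" using i by (auto simp: cyclic_class_def intro!: exI[of _ 0])
  have C_sub: "?C \<subseteq> c" by (auto simp: cyclic_class_def)
  define f where "f m \<omega> = (MAX p\<in>?C \<times> ?C. h (g * m) (fst p) (snd p) \<omega>)" for m \<omega>
  have f_ge: "h (g * m) j k \<omega> \<le> f m \<omega>" if "j \<in> ?C" "k \<in> ?C" for m j k \<omega>
    unfolding f_def using that Max_image_ge[of "?C \<times> ?C" "(j, k)" "\<lambda>p. h (g * m) (fst p) (snd p) \<omega>"]
    by simp
  have f_attained: "\<exists>j\<in>?C. \<exists>k\<in>?C. f m \<omega> = h (g * m) j k \<omega>" for m \<omega>
  proof -
    have "?C \<times> ?C \<noteq> {}" using i_in by blast
    then obtain p where "p \<in> ?C \<times> ?C" "f m \<omega> = h (g * m) (fst p) (snd p) \<omega>"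
      unfolding f_def using Max_image_attained[of "?C \<times> ?C" "\<lambda>p. h (g * m) (fst p) (snd p) \<omega>"] by auto
    moreover have "fst p \<in> ?C" "snd p \<in> ?C" using calculation by auto
    ultimately show ?thesis by blast
  qed
  have int_h: "integrable P (h (g * m) j k)" if "j \<in> ?C" "k \<in> ?C" "m \<ge> K" for m j k
    using integrable_val[OF c_nonempty _ _ cyclic_class_path[OF i that]] that C_sub by blast
  have int_f: "integrable P (f m)" if "m \<ge> K" for m
  proof -
    \<comment> \<open>Integrability of a finite maximum is taken from
      \<open>integrable_or_minf_Max\<close>, hence the passage through \<open>ereal\<close>.\<close>
    have "integrable_or_minf True (\<lambda>\<omega>. ereal (h (g * m) (fst p) (snd p) \<omega>))" if "p \<in> ?C \<times> ?C" for p
      unfolding integrable_or_minf_def using that int_h[of "fst p" "snd p" m] \<open>m \<ge> K\<close>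
      by (auto intro!: exI[of _ "h (g * m) (fst p) (snd p)"])
    then have "integrable_or_minf (\<exists>p\<in>?C \<times> ?C. True)
        (\<lambda>\<omega>. MAX p\<in>?C \<times> ?C. ereal (h (g * m) (fst p) (snd p) \<omega>))"
      using i_in by (intro integrable_or_minf_Max) auto
    moreover have "(MAX p\<in>?C \<times> ?C. ereal (h (g * m) (fst p) (snd p) \<omega>)) = ereal (f m \<omega>)" for \<omega>
      unfolding f_def using i_in
      by (subst mono_Max_commute[of ereal]) (auto simp: image_image mono_def)
    ultimately obtain f' where "integrable P f'" "\<And>\<omega>. f m \<omega> = f' \<omega>"
      using i_in by (auto simp: integrable_or_minf_def split: if_splits)
    then show ?thesis by (metis ext)
  qed
  have sub: "f (m + n) \<omega> \<le> f m (((\<theta> ^^ g) ^^ n) \<omega>) + f n \<omega>" if mn: "m \<ge> K" "n \<ge> K" for m n \<omega>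
  proof -
    obtain j k where jk: "j \<in> ?C" "k \<in> ?C" "f (m + n) \<omega> = h (g * (m + n)) j k \<omega>"
      using f_attained by blast
    have jkc: "j \<in> c" "k \<in> c" using jk C_sub by auto
    obtain l where l: "l \<in> c" "S c (g * m + g * n) \<omega> j k
        \<le> S c (g * m) ((\<theta> ^^ (g * n)) \<omega>) j l + S c (g * n) \<omega> l k"
      using S_add_split[OF c_nonempty jkc(1)] by blast
    have eq: "S c (g * m + g * n) \<omega> j k = ereal (f (m + n) \<omega>)"
      using S_eq_val[OF c_nonempty jkc cyclic_class_path[OF i jk(1,2)], of "m + n" \<omega>] mn jk(3)
      by (simp add: distrib_left)
    \<comment> \<open>The left side of the split is finite, so neither summand can be -\<infinity>;
      a walk to the intermediate node exists, which places \<open>l\<close> in the class.\<close>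
    have "(j, l) \<in> Ec ^^ (g * m)"
    proof (rule ccontr)
      assume "(j, l) \<notin> Ec ^^ (g * m)"
      then have "S c (g * m) ((\<theta> ^^ (g * n)) \<omega>) j l = - \<infinity>"
        using S_eq_minf[OF c_nonempty jkc(1) l(1)] by blast
      then show False using l(2) S_neq_PInf[OF c_nonempty, of "g * n" \<omega> l k] unfolding eq
        by (cases "S c (g * n) \<omega> l k") auto
    qed
    moreover obtain u where "(i, j) \<in> Ec ^^ (g * u)" using jk by (auto simp: cyclic_class_def)
    ultimately have "(i, l) \<in> Ec ^^ (g * (u + m))" using relpow_trans by (simp add: distrib_left)
    then have lC: "l \<in> ?C" using l by (auto simp: cyclic_class_def)
    have "f (m + n) \<omega> \<le> h (g * m) j l ((\<theta> ^^ (g * n)) \<omega>) + h (g * n) l k \<omega>"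
      using l(2) S_eq_val[OF c_nonempty jkc(1) l(1) cyclic_class_path[OF i jk(1) lC mn(1)]]
        S_eq_val[OF c_nonempty l(1) jkc(2) cyclic_class_path[OF i lC jk(2) mn(2)]]
      unfolding eq by simp
    also have "\<dots> \<le> f m ((\<theta> ^^ (g * n)) \<omega>) + f n \<omega>" using jk lC by (intro add_mono f_ge) auto
    finally show ?thesis by (simp add: funpow_g)
  qed
  obtain H where H: "integrable P H"
    "\<And>r i j \<omega>. r \<le> g * K \<Longrightarrow> i \<in> c \<Longrightarrow> j \<in> c \<Longrightarrow> (i, j) \<in> Ec ^^ r \<Longrightarrow> \<bar>h r i j \<omega>\<bar> \<le> H \<omega>"
    using val_bounded_by_integrable[OF c_nonempty, of "g * K"] by blast
  \<comment> \<open>Extending the best path inside the class to a loop at \<open>i\<close> costs a bounded expectation.\<close>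
  have E_f: "integral\<^sup>L P (f N) \<le> rate * real (g * N) + (2 * rate * real (g * K) + 2 * integral\<^sup>L P H)"
    if N: "N > K" for N
  proof -
    have bound: "f N ((\<theta> ^^ (g * K)) \<omega>)
        \<le> h (g * (K + N + K)) i i \<omega> + H ((\<theta> ^^ (g * (N + K))) \<omega>) + H \<omega>" for \<omega>
    proof -
      obtain j k where jk: "j \<in> ?C" "k \<in> ?C"
          "f N ((\<theta> ^^ (g * K)) \<omega>) = h (g * N) j k ((\<theta> ^^ (g * K)) \<omega>)" using f_attained by blast
      have jkc: "j \<in> c" "k \<in> c" using jk C_sub by auto
      have p: "(i, j) \<in> Ec ^^ (g * K)" "(j, k) \<in> Ec ^^ (g * N)" "(k, i) \<in> Ec ^^ (g * K)"
        using cyclic_class_path[OF i] jk i_in N by auto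
      have "h (g * N) j k ((\<theta> ^^ (g * K)) \<omega>) + h (g * K) k i \<omega> \<le> h (g * N + g * K) j i \<omega>"
        using val_add_ge[OF c_nonempty jkc i p(2,3)] .
      moreover have "h (g * K) i j ((\<theta> ^^ (g * N + g * K)) \<omega>) + h (g * N + g * K) j i \<omega>
          \<le> h (g * K + (g * N + g * K)) i i \<omega>"
        using val_add_ge[OF c_nonempty i jkc(1) i p(1) relpow_trans[OF p(2,3)]] .
      moreover have "\<bar>h (g * K) k i \<omega>\<bar> \<le> H \<omega>" using H(2) jkc i p by auto
      moreover have "\<bar>h (g * K) i j ((\<theta> ^^ (g * N + g * K)) \<omega>)\<bar> \<le> H ((\<theta> ^^ (g * N + g * K)) \<omega>)"
        using H(2) jkc i p by auto
      ultimately show ?thesis unfolding jk(3) by (simp add: distrib_left add.assoc)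
    qed
    have hi: "integrable P (h (g * (K + N + K)) i i)"
      using integrable_val[OF c_nonempty i i loop_path[OF i]] by simp
    have "integral\<^sup>L P (f N) = (\<integral>\<omega>. f N ((\<theta> ^^ (g * K)) \<omega>) \<partial>P)"
      using integral_funpow int_f N by simp
    also have "\<dots> \<le> (\<integral>\<omega>. h (g * (K + N + K)) i i \<omega> + H ((\<theta> ^^ (g * (N + K))) \<omega>) + H \<omega> \<partial>P)"
      using bound int_f N H(1) hi by (intro integral_mono integrable_funpow Bochner_Integration.integrable_add) auto
    also have "\<dots> = mean_val (g * (K + N + K)) i i + 2 * integral\<^sup>L P H"
      unfolding mean_val_def using hi H(1) integrable_funpow[OF H(1)] integral_funpow[OF H(1)] by simp
    also have "mean_val (g * (K + N + K)) i i \<le> rate * real (g * (K + N + K))"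
      using N by (intro mean_val_le_rate i) auto
    finally show ?thesis by (simp add: algebra_simps)
  qed
  define B where "B = 2 * rate * real (g * K) + 2 * integral\<^sup>L P H"
  have "AE \<omega> in P. \<forall>k::nat. \<forall>\<epsilon>>0. \<exists>C. \<forall>s m. m \<ge> K \<longrightarrow>
      f m (((\<theta> ^^ g) ^^ s) \<omega>)
        \<le> (rate * real g + inverse (real (Suc k))) * real m + \<epsilon> * real (s + m) + C"
  proof (subst AE_all_countable, rule allI)
    fix k :: nat
    \<comment> \<open>\<open>N\<close> is so large that the bounded cost \<open>B\<close> of closing
      a path, divided by \<open>N\<close>, is below the tolerance.\<close>
    obtain N' :: nat where N': "B * real (Suc k) < real N'" using reals_Archimedean2 by blast
    define N where "N = Suc (N' + K)"
    have N: "N > K" by (simp add: N_def)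
    have "B * real (Suc k) \<le> real N" using N' by (simp add: N_def)
    then have "B \<le> inverse (real (Suc k)) * real N" by (simp add: field_simps)
    then have int_le: "integral\<^sup>L P (f N) \<le> (rate * real g + inverse (real (Suc k))) * real N"
      using E_f[OF N] unfolding B_def by (simp add: algebra_simps)
    show "AE \<omega> in P. \<forall>\<epsilon>>0. \<exists>C. \<forall>s m. m \<ge> K \<longrightarrow> f m (((\<theta> ^^ g) ^^ s) \<omega>)
        \<le> (rate * real g + inverse (real (Suc k))) * real m + \<epsilon> * real (s + m) + C"
      by (rule T.AE_subadditive_upper[where N = N]) (use N int_f sub int_le in auto)
  qed
  then show ?thesis
  proof eventually_elim
    case (elim \<omega>)
    show ?case
    proof (intro allI impI)
      fix \<delta> :: real assume \<delta>: "\<delta> > 0"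
      then obtain k where k: "inverse (real (Suc k)) < \<delta> / 2"
        using reals_Archimedean[of "\<delta> / 2"] by auto
      have "\<delta> / 2 > 0" using \<delta> by simp
      then obtain C where C: "\<forall>s m. m \<ge> K \<longrightarrow> f m (((\<theta> ^^ g) ^^ s) \<omega>)
        \<le> (rate * real g + inverse (real (Suc k))) * real m + \<delta> / 2 * real (s + m) + C"
        using elim by blast
      have "h (g * m) j k' ((\<theta> ^^ (g * s)) \<omega>) \<le> rate * real (g * m) + \<delta> * real (s + m) + C"
        if "j \<in> ?C" "k' \<in> ?C" "m > K" for s m j k'
      proof -
        have "h (g * m) j k' ((\<theta> ^^ (g * s)) \<omega>) \<le> f m (((\<theta> ^^ g) ^^ s) \<omega>)"
          using f_ge[OF that(1,2)] by (simp add: funpow_g)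
        also have "\<dots> \<le> (rate * real g + inverse (real (Suc k))) * real m + \<delta> / 2 * real (s + m) + C"
          using C that(3) by simp
        finally have "h (g * m) j k' ((\<theta> ^^ (g * s)) \<omega>)
            \<le> (rate * real g + inverse (real (Suc k))) * real m + \<delta> / 2 * real (s + m) + C" .
        moreover have "inverse (real (Suc k)) * real m \<le> \<delta> / 2 * real (s + m)"
          using k \<delta> by (intro mult_mono) auto
        moreover have "(rate * real g + inverse (real (Suc k))) * real m
            = rate * real (g * m) + inverse (real (Suc k)) * real m"
          by (simp add: algebra_simps)
        moreover have "\<delta> * real (s + m) = \<delta> / 2 * real (s + m) + \<delta> / 2 * real (s + m)" by simp
        ultimately show ?thesis by linarith
      qed
      then show "\<exists>C. \<forall>s m. \<forall>j\<in>?C. \<forall>k\<in>?C. m > K \<longrightarrow>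
          h (g * m) j k ((\<theta> ^^ (g * s)) \<omega>) \<le> rate * real (g * m) + \<delta> * real (s + m) + C"
        by blast
    qed
  qed
qed

text \<open>The class bound covers lengths and starting times that are multiples of
  \<open>g\<close>. Both residues are below \<open>g\<close> and are treated separately: the one of
  the length by a short product, the one of the starting time by shifting
  \<open>\<omega>\<close>.\<close>

lemma AE_upper:
  "AE \<omega> in P. \<forall>\<delta>>0. \<exists>C. \<forall>s n. \<forall>i\<in>c. \<forall>j\<in>c.
    S c n ((\<theta> ^^ s) \<omega>) i j \<le> ereal (rate * real n + \<delta> * real (s + n) + C)"
proof -
  \<comment> \<open>Majorises every product of length at most \<open>g * K + g\<close>: the
    remainders below one period, and the lengths too short for the class bound.\<close>
  define W where "W = birkhoff_sum \<theta> weight (g * K + g)"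
  have "AE \<omega> in P. \<forall>i\<in>c. \<forall>r. \<forall>\<delta>>0. \<exists>C. \<forall>s m. \<forall>j\<in>cyclic_class i. \<forall>k\<in>cyclic_class i.
      m > K \<longrightarrow> h (g * m) j k ((\<theta> ^^ (g * s)) ((\<theta> ^^ r) \<omega>)) \<le> rate * real (g * m) + \<delta> * real (s + m) + C"
    by (intro AE_ball_countable' AE_all_funpow AE_class_upper) (auto intro: countable_finite)
  moreover have "integrable P W" unfolding W_def by (intro integrable_birkhoff_sum integrable_weight)
  note AE_sublinear_orbit[OF this]
  ultimately show ?thesis
  proof eventually_elim
    case (elim \<omega>)
    show ?case
    proof (intro allI impI)
      fix \<delta> :: real assume \<delta>: "\<delta> > 0"
      then have \<delta>2: "\<delta> / 2 > 0" by simp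
      have "\<forall>i\<in>c. \<forall>r. \<exists>C. \<forall>s m. \<forall>j\<in>cyclic_class i. \<forall>k\<in>cyclic_class i. m > K \<longrightarrow>
          h (g * m) j k ((\<theta> ^^ (g * s)) ((\<theta> ^^ r) \<omega>)) \<le> rate * real (g * m) + \<delta> / 2 * real (s + m) + C"
        using elim(1) \<delta>2 by blast
      then obtain C where C: "\<And>i r s m j k. i \<in> c \<Longrightarrow> j \<in> cyclic_class i \<Longrightarrow> k \<in> cyclic_class i \<Longrightarrow> m > K \<Longrightarrow>
          h (g * m) j k ((\<theta> ^^ (g * s)) ((\<theta> ^^ r) \<omega>)) \<le> rate * real (g * m) + \<delta> / 2 * real (s + m) + C i r"
        by metis
      define C' where "C' = (\<Sum>(i, r)\<in>c \<times> {..<g}. \<bar>C i r\<bar>)"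
      have C': "C i r \<le> C'" if "i \<in> c" "r < g" for i r
      proof -
        have "\<bar>C i r\<bar> \<le> C'"
          unfolding C'_def using that
            member_le_sum[of "(i, r)" "c \<times> {..<g}" "\<lambda>(i, r). \<bar>C i r\<bar>"] by auto
        then show ?thesis by linarith
      qed
      have mult: "S c (g * m) ((\<theta> ^^ s) \<omega>) i j
          \<le> ereal (rate * real (g * m) + \<delta> / 2 * real (s + m) + C')"
        if ij: "i \<in> c" "j \<in> c" and m: "m > K" for s m i j
      proof (cases "(i, j) \<in> Ec ^^ (g * m)")
        case True
        \<comment> \<open>The residue of \<open>s\<close> moves into the base point
          \<open>(\<theta> ^^ r) \<omega>\<close>; the class bound was secured for all these
          shifts.\<close>
        define q r where "q = s div g" and "r = s mod g"
        have s: "s = g * q + r" "r < g" using g_pos by (auto simp: q_def r_def)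
        have "(i, i) \<in> Ec ^^ (g * 0)" by simp
        then have cl: "i \<in> cyclic_class i" "j \<in> cyclic_class i"
          using ij True unfolding cyclic_class_def by blast+
        have "h (g * m) i j ((\<theta> ^^ s) \<omega>) \<le> rate * real (g * m) + \<delta> / 2 * real (q + m) + C'"
          using C[OF ij(1) cl m, of q r] C'[OF ij(1) s(2)] by (simp add: funpow_shift s)
        moreover have "q \<le> s" by (simp add: q_def)
        then have "\<delta> / 2 * real (q + m) \<le> \<delta> / 2 * real (s + m)" using \<delta> by (intro mult_left_mono) auto
        ultimately show ?thesis using S_eq_val[OF c_nonempty ij True] by simp
      qed (use S_eq_minf[OF c_nonempty ij] in simp)
      obtain D where D: "\<And>n. \<bar>W ((\<theta> ^^ n) \<omega>)\<bar> \<le> \<delta> / 2 * real n + D"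
        using sublinearD[OF elim(2) \<delta>2] by blast
      have small: "S c n ((\<theta> ^^ s) \<omega>) i j \<le> ereal (\<delta> / 2 * real s + D)"
        if "n \<le> g * K + g" for n s i j
      proof -
        have "birkhoff_sum \<theta> weight n ((\<theta> ^^ s) \<omega>) \<le> W ((\<theta> ^^ s) \<omega>)"
          unfolding W_def birkhoff_sum_def using that weight_nonneg by (intro sum_mono2) auto
        then have "birkhoff_sum \<theta> weight n ((\<theta> ^^ s) \<omega>) \<le> \<delta> / 2 * real s + D"
          using D[of s] by linarith
        then show ?thesis
          using S_le_birkhoff_sum[OF c_nonempty, of n "(\<theta> ^^ s) \<omega>" i j] order_trans
          by (metis ereal_less_eq(3))
      qed
      have "C' \<ge> 0" unfolding C'_def by (intro sum_nonneg) auto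
      have "D \<ge> 0" using D[of 0] by simp
      \<comment> \<open>On short stretches only \<open>W\<close> gives control; \<open>R\<close>
        compensates \<open>rate * real n\<close> there, for either sign of the rate.\<close>
      define R where "R = \<bar>rate\<bar> * real (g * K + g)"
      have R: "- (rate * real n) \<le> R" if "n \<le> g * K + g" for n
      proof -
        have "- (rate * real n) \<le> \<bar>rate\<bar> * real n"
          using mult_right_mono[of "- rate" "\<bar>rate\<bar>" "real n"] by simp
        also have "\<dots> \<le> R" unfolding R_def using that by (intro mult_left_mono) (auto simp del: of_nat_add)
        finally show ?thesis .
      qed
      define B where "B = R + C' + D"
      have "S c n ((\<theta> ^^ s) \<omega>) i j \<le> ereal (rate * real n + \<delta> * real (s + n) + B)"
        if ij: "i \<in> c" "j \<in> c" for s n i j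
      proof (cases "n \<le> g * K + g")
        case True
        have "\<delta> / 2 * real s \<le> \<delta> * real (s + n)" using \<delta> by (intro mult_mono) auto
        then have "\<delta> / 2 * real s + D \<le> rate * real n + \<delta> * real (s + n) + B"
          using R[OF True] \<open>C' \<ge> 0\<close> unfolding B_def by linarith
        then show ?thesis by (intro order_trans[OF small[OF True, of s i j]]) simp
      next
        case False
        define m r where "m = n div g" and "r = n mod g"
        have nmr: "n = r + g * m" by (simp add: m_def r_def)
        have r: "r < g" using g_pos by (simp add: r_def)
        have "m > K"
        proof (rule ccontr)
          assume "\<not> m > K"
          then have "g * m \<le> g * K" by simp
          then show False using False nmr r by linarith
        qed
        obtain k where k: "k \<in> c" "S c (r + g * m) ((\<theta> ^^ s) \<omega>) i j
            \<le> S c r ((\<theta> ^^ (g * m)) ((\<theta> ^^ s) \<omega>)) i k + S c (g * m) ((\<theta> ^^ s) \<omega>) k j"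
          using S_add_split[OF c_nonempty ij(1)] by blast
        note k(2)
        also have "S c r ((\<theta> ^^ (g * m)) ((\<theta> ^^ s) \<omega>)) i k + S c (g * m) ((\<theta> ^^ s) \<omega>) k j
            \<le> ereal (\<delta> / 2 * real (g * m + s) + D) + ereal (rate * real (g * m) + \<delta> / 2 * real (s + m) + C')"
          unfolding funpow_shift using r by (intro add_mono small mult k ij \<open>m > K\<close>) auto
        also have "\<dots> \<le> ereal (rate * real n + \<delta> * real (s + n) + B)"
        proof -
          have "m \<le> g * m" using g_pos by simp
          then have "m \<le> n" "g * m \<le> n" unfolding nmr by linarith+
          then have "\<delta> / 2 * real (g * m + s) \<le> \<delta> / 2 * real (s + n)" "\<delta> / 2 * real (s + m) \<le> \<delta> / 2 * real (s + n)"
            using \<delta> by (auto intro!: mult_left_mono simp del: of_nat_mult of_nat_add)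
          moreover have "- (rate * real r) \<le> R" using r by (intro R) simp
          moreover have "rate * real n = rate * real r + rate * real (g * m)" by (simp add: nmr algebra_simps)
          moreover have "\<delta> * real (s + n) = \<delta> / 2 * real (s + n) + \<delta> / 2 * real (s + n)" by simp
          ultimately have "(\<delta> / 2 * real (g * m + s) + D) + (rate * real (g * m) + \<delta> / 2 * real (s + m) + C')
              \<le> rate * real n + \<delta> * real (s + n) + B" unfolding B_def by linarith
          then show ?thesis by simp
        qed
        finally show ?thesis by (simp add: nmr)
      qed
      then show "\<exists>C. \<forall>s n. \<forall>i\<in>c. \<forall>j\<in>c.
          S c n ((\<theta> ^^ s) \<omega>) i j \<le> ereal (rate * real n + \<delta> * real (s + n) + C)" by blast
    qed
  qed
qed

end


section \<open>From components to orbits\<close>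

lemma tendsto_rate:
  fixes u :: "nat \<Rightarrow> ereal"
  assumes upper: "\<And>\<delta>. \<delta> > 0 \<Longrightarrow> \<exists>C. \<forall>n. u n \<le> ereal (\<rho> * real n + \<delta> * real n + C)"
    and lower: "\<And>\<delta>. \<delta> > 0 \<Longrightarrow> \<forall>\<^sub>F n in sequentially. ereal ((\<rho> - \<delta>) * real n) \<le> u n"
  shows "(\<lambda>n. ereal (1 / real n) * u n) \<longlonglongrightarrow> ereal \<rho>"
proof (rule order_tendstoI)
  fix b assume "b < ereal \<rho>"
  then obtain b' where b': "b < ereal b'" "b' < \<rho>" using ereal_dense2 by (metis less_ereal.simps(1))
  have "\<forall>\<^sub>F n in sequentially. ereal ((\<rho> - (\<rho> - b')) * real n) \<le> u n" using b' by (intro lower) simp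
  then show "\<forall>\<^sub>F n in sequentially. b < ereal (1 / real n) * u n"
    using eventually_gt_at_top[of 0]
  proof eventually_elim
    case (elim n)
    have "ereal (1 / real n) * ereal (b' * real n) \<le> ereal (1 / real n) * u n"
      using elim by (intro ereal_mult_left_mono) auto
    then show ?case using b'(1) elim(2) by (auto intro: less_le_trans)
  qed
next
  fix b assume "ereal \<rho> < b"
  then obtain b' where b': "ereal b' < b" "\<rho> < b'" using ereal_dense2 by (metis less_ereal.simps(1))
  define \<delta> where "\<delta> = (b' - \<rho>) / 2"
  have \<delta>: "\<delta> > 0" using b' by (simp add: \<delta>_def)
  obtain C where C: "\<And>n. u n \<le> ereal (\<rho> * real n + \<delta> * real n + C)" using upper[OF \<delta>] by blast
  obtain n0 :: nat where n0: "C / \<delta> < real n0" using reals_Archimedean2 by blast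
  show "\<forall>\<^sub>F n in sequentially. ereal (1 / real n) * u n < b"
    using eventually_gt_at_top[of n0]
  proof eventually_elim
    case (elim n)
    have "C < \<delta> * real n0" using n0 \<delta> by (simp add: field_simps)
    also have "\<dots> \<le> \<delta> * real n" using elim \<delta> by (intro mult_left_mono) auto
    finally have "\<rho> * real n + \<delta> * real n + C \<le> b' * real n" by (simp add: \<delta>_def field_simps)
    then have "u n \<le> ereal (b' * real n)" using C[of n] by (meson ereal_less_eq(3) order_trans)
    then have "ereal (1 / real n) * u n \<le> ereal (1 / real n) * ereal (b' * real n)"
      by (intro ereal_mult_left_mono) auto
    then show ?case using b'(1) elim by (auto intro: le_less_trans)
  qed
qed

text \<open>Two constants that are almost sure limits of the same sequence agree on a set of
  probability one, which is nonempty. This settles the definite description.\<close>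

lemma (in prob_space) max_lyapunov_eqI:
  assumes "AE \<omega> in M.
    (\<lambda>n. ereal (1 / real n) * (MAX (i, j)\<in>I \<times> I. mp_prod I (\<lambda>k. B k \<omega>) n i j)) \<longlonglongrightarrow> l"
  shows "max_lyapunov M I B = l"
  unfolding max_lyapunov_def
proof (rule the_equality)
  fix l' assume "AE \<omega> in M.
    (\<lambda>n. ereal (1 / real n) * (MAX (i, j)\<in>I \<times> I. mp_prod I (\<lambda>k. B k \<omega>) n i j)) \<longlonglongrightarrow> l'"
  then have "AE \<omega> in M. l' = l"
    using assms by eventually_elim (rule LIMSEQ_unique)
  then show "l' = l" by simp
qed fact

text \<open>Since no row is -\<infinity>, every node reaches a cycle, hence a component with an arc;
  this is the source of the finiteness of the limit.\<close>

lemma rtrancl_pigeonhole: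
  fixes E :: "('d::finite \<times> 'd) set"
  assumes "\<And>i. \<exists>j. (i, j) \<in> E"
  shows "\<exists>j k. (i, j) \<in> E\<^sup>* \<and> (j, k) \<in> E \<and> (k, j) \<in> E\<^sup>*"
proof -
  obtain \<sigma> where \<sigma>: "\<And>i. (i, \<sigma> i) \<in> E" using assms by metis
  have walk: "(j, (\<sigma> ^^ n) j) \<in> E\<^sup>*" for j n
    using \<sigma> by (induction n) (auto intro: rtrancl_into_rtrancl)
  have "\<not> inj (\<lambda>n. (\<sigma> ^^ n) i)"
    using finite_subset[OF subset_UNIV] finite_imageD[of "\<lambda>n. (\<sigma> ^^ n) i" UNIV] by auto
  then obtain m n where mn: "m < n" "(\<sigma> ^^ m) i = (\<sigma> ^^ n) i"
    unfolding inj_on_def by (metis nat_neq_iff)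
  define j where "j = (\<sigma> ^^ m) i"
  have "n = (n - Suc m) + Suc m" using mn by simp
  then have "(\<sigma> ^^ n) i = (\<sigma> ^^ (n - Suc m)) (\<sigma> j)"
    unfolding j_def by (metis comp_apply funpow.simps(2) funpow_add)
  then have "(\<sigma> j, j) \<in> E\<^sup>*" using walk[of "\<sigma> j" "n - Suc m"] mn by (simp add: j_def)
  then show ?thesis using walk[of i m] \<sigma>[of j] unfolding j_def by blast
qed

section \<open>Two-sided rates of components\<close>

context mp_system
begin

text \<open>All windows are covered, with an error that may grow with the end of the window; within
  a product of length \<open>n\<close> this end never exceeds \<open>n\<close>.\<close>

definition upper_rate :: "'d set \<Rightarrow> real \<Rightarrow> 'w \<Rightarrow> bool" where
  "upper_rate c q \<omega> \<longleftrightarrow> (\<forall>\<delta>>0. \<exists>C. \<forall>s n. \<forall>i\<in>c. \<forall>j\<in>c.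
    S c n ((\<theta> ^^ s) \<omega>) i j \<le> ereal (q * real n + \<delta> * real (s + n) + C))"

text \<open>The window starts at time 0: a walk that ends in the best component spends the earliest
  times there.\<close>

definition lower_rate :: "'d set \<Rightarrow> real \<Rightarrow> 'w \<Rightarrow> bool" where
  "lower_rate c q \<omega> \<longleftrightarrow> (\<forall>\<delta>>0. \<forall>\<^sub>F n in sequentially. \<forall>i\<in>c. \<exists>j\<in>c.
    ereal ((q - \<delta>) * real n) \<le> S c n \<omega> i j)"

lemma upper_rate_mono:
  assumes "upper_rate c q \<omega>" "q \<le> q'"
  shows "upper_rate c q' \<omega>"
  unfolding upper_rate_def
proof (intro allI impI)
  fix \<delta> :: real assume "\<delta> > 0"
  then obtain C where C: "\<And>s n i j. i \<in> c \<Longrightarrow> j \<in> c \<Longrightarrow>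
      S c n ((\<theta> ^^ s) \<omega>) i j \<le> ereal (q * real n + \<delta> * real (s + n) + C)"
    using assms(1) unfolding upper_rate_def by blast
  have "S c n ((\<theta> ^^ s) \<omega>) i j \<le> ereal (q' * real n + \<delta> * real (s + n) + C)"
    if "i \<in> c" "j \<in> c" for s n i j
  proof (rule order_trans[OF C[OF that]])
    have "q * real n \<le> q' * real n" using assms(2) by (intro mult_right_mono) auto
    then show "ereal (q * real n + \<delta> * real (s + n) + C) \<le> ereal (q' * real n + \<delta> * real (s + n) + C)"
      by simp
  qed
  then show "\<exists>C. \<forall>s n. \<forall>i\<in>c. \<forall>j\<in>c.
      S c n ((\<theta> ^^ s) \<omega>) i j \<le> ereal (q' * real n + \<delta> * real (s + n) + C)" by blast
qed

lemma strongly_connected_rate: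
  assumes "c \<noteq> {}" and conn: "\<And>i j. i \<in> c \<Longrightarrow> j \<in> c \<Longrightarrow> (i, j) \<in> (E_on c)\<^sup>+"
  shows "\<exists>\<rho>. (AE \<omega> in P. upper_rate c \<rho> \<omega>) \<and> (AE \<omega> in P. lower_rate c \<rho> \<omega>)"
proof -
  have c_fin: "finite c" by simp
  obtain g K where gK: "g \<in> {1..card c}"
    "\<And>i n. i \<in> c \<Longrightarrow> (i, i) \<in> E_on c ^^ n \<Longrightarrow> g dvd n"
    "\<And>i j l m. i \<in> c \<Longrightarrow> j \<in> c \<Longrightarrow> (i, j) \<in> E_on c ^^ (g * l) \<Longrightarrow> m \<ge> K \<Longrightarrow>
       (i, j) \<in> E_on c ^^ (g * m)"
    using strongly_connected_period[OF c_fin assms] by blast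
  interpret C: periodic_component P \<theta> E a c g K
  proof
    show "\<exists>n. (i, j) \<in> E_on c ^^ n" if "i \<in> c" "j \<in> c" for i j
      using conn[OF that] by (auto simp: trancl_power)
    show "\<exists>j\<in>c. (i, j) \<in> E" if "i \<in> c" for i
      using tranclD[OF conn[OF that that]] by blast
  qed (use assms gK in auto)
  show ?thesis
    using C.AE_upper C.AE_lower unfolding upper_rate_def lower_rate_def by blast
qed

section \<open>Components with and without arcs\<close>

definition component_of :: "'d \<Rightarrow> 'd set" where
  "component_of i = {j. (i, j) \<in> E\<^sup>* \<and> (j, i) \<in> E\<^sup>*}"

lemma component_of_self: "i \<in> component_of i"
  by (simp add: component_of_def)

text \<open>Every node on such a walk is reachable from \<open>i\<close> and reaches
  \<open>i\<close>, so the walk cannot leave the component.\<close>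

lemma component_of_walk:
  assumes "j \<in> component_of i" "(j, k) \<in> E\<^sup>*" "k \<in> component_of i"
  shows "(j, k) \<in> (E_on (component_of i))\<^sup>*"
  using assms(2,1)
proof (induction rule: converse_rtrancl_induct)
  case (step j l)
  have "(i, l) \<in> E\<^sup>*" using step by (auto simp: component_of_def intro: rtrancl_into_rtrancl)
  moreover have "(l, i) \<in> E\<^sup>*" using step(2) assms(3) by (auto simp: component_of_def)
  ultimately have "l \<in> component_of i" by (simp add: component_of_def)
  then show ?case using step by (auto intro: converse_rtrancl_into_rtrancl)
qed simp

text \<open>Routing through one arc makes the walk nonempty even for \<open>j = k\<close>, which is
  impossible for a single node without loop.\<close>

lemma component_of_connected:
  assumes "E_on (component_of i) \<noteq> {}" "j \<in> component_of i" "k \<in> component_of i"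
  shows "(j, k) \<in> (E_on (component_of i))\<^sup>+"
proof -
  obtain u v where uv: "(u, v) \<in> E_on (component_of i)" using assms(1) by auto
  have "(j, u) \<in> E\<^sup>*" "(v, k) \<in> E\<^sup>*"
    using uv assms(2,3) rtrancl_trans[of j i E u] rtrancl_trans[of v i E k] by (auto simp: component_of_def)
  then have "(j, u) \<in> (E_on (component_of i))\<^sup>*" "(v, k) \<in> (E_on (component_of i))\<^sup>*"
    using component_of_walk uv assms by auto
  then show ?thesis using uv by (meson rtrancl_into_trancl1 trancl_rtrancl_trancl)
qed

lemma S_trivial:
  assumes "E_on c = {}" "i \<in> c" "j \<in> c" "n > 0"
  shows "S c n \<omega> i j = - \<infinity>"
proof -
  have "E_on c ^^ n = {}" using assms(1,4) by (cases n) auto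
  then show ?thesis using assms(2,3) by (intro S_eq_minf) auto
qed

text \<open>Products of positive length are -\<infinity>, and length 0 contributes at most 0. As
  \<open>q\<close> is arbitrary, such components can share the bound of the others.\<close>

lemma trivial_upper_rate:
  assumes "E_on c = {}"
  shows "upper_rate c q \<omega>"
  unfolding upper_rate_def
proof (intro allI impI exI[of _ 0] ballI)
  fix \<delta> :: real and s n i j assume "\<delta> > 0" "i \<in> c" "j \<in> c"
  then show "S c n ((\<theta> ^^ s) \<omega>) i j \<le> ereal (q * real n + \<delta> * real (s + n) + 0)"
    using S_trivial[OF assms] by (cases "n = 0") (auto simp: S_0)
qed

definition growth :: "'d set \<Rightarrow> 'w \<Rightarrow> ereal \<Rightarrow> bool" where
  "growth c \<omega> l \<longleftrightarrow> (\<lambda>n. ereal (1 / real n) *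
     (MAX (i, j)\<in>c \<times> c. mp_prod c (\<lambda>t. mat ((\<theta> ^^ t) \<omega>)) n i j)) \<longlonglongrightarrow> l"

lemma growth_rate:
  assumes c: "c \<noteq> {}" and up: "upper_rate c \<rho> \<omega>" and lo: "lower_rate c \<rho> \<omega>"
  shows "growth c \<omega> (ereal \<rho>)"
  unfolding growth_def S_def[symmetric]
proof (rule tendsto_rate)
  fix \<delta> :: real assume \<delta>: "\<delta> > 0"
  obtain C where C: "\<And>s n i j. i \<in> c \<Longrightarrow> j \<in> c \<Longrightarrow>
      S c n ((\<theta> ^^ s) \<omega>) i j \<le> ereal (\<rho> * real n + \<delta> * real (s + n) + C)"
    using up \<delta> unfolding upper_rate_def by blast
  have "(MAX (i, j)\<in>c \<times> c. S c n \<omega> i j) \<le> ereal (\<rho> * real n + \<delta> * real n + C)" for n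
    using C[of _ _ n 0] c by (intro Max.boundedI) auto
  then show "\<exists>C. \<forall>n. (MAX (i, j)\<in>c \<times> c. S c n \<omega> i j) \<le> ereal (\<rho> * real n + \<delta> * real n + C)"
    by blast
  have "\<forall>\<^sub>F n in sequentially. \<forall>i\<in>c. \<exists>j\<in>c. ereal ((\<rho> - \<delta>) * real n) \<le> S c n \<omega> i j"
    using lo \<delta> unfolding lower_rate_def by blast
  then show "\<forall>\<^sub>F n in sequentially. ereal ((\<rho> - \<delta>) * real n) \<le> (MAX (i, j)\<in>c \<times> c. S c n \<omega> i j)"
  proof eventually_elim
    case (elim n)
    obtain i where "i \<in> c" using c by blast
    then obtain j where j: "j \<in> c" "ereal ((\<rho> - \<delta>) * real n) \<le> S c n \<omega> i j" using elim by blast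
    note j(2)
    also have "S c n \<omega> i j \<le> (MAX (i, j)\<in>c \<times> c. S c n \<omega> i j)"
      using Max_image_ge[of "c \<times> c" "(i, j)" "\<lambda>(i, j). S c n \<omega> i j"] \<open>i \<in> c\<close> j(1) by simp
    finally show ?case .
  qed
qed

lemma growth_trivial:
  assumes c: "c \<noteq> {}" and trivial: "E_on c = {}"
  shows "growth c \<omega> (- \<infinity>)"
proof -
  have "ereal (1 / real n) * (MAX (i, j)\<in>c \<times> c. S c n \<omega> i j) = - \<infinity>" if "n > 0" for n
  proof -
    have "(\<lambda>(i, j). S c n \<omega> i j) ` (c \<times> c) = (\<lambda>_. - \<infinity>) ` (c \<times> c)"
      using S_trivial[OF trivial _ _ that] by (intro image_cong) auto
    then show ?thesis using c that by (simp add: image_constant_conv)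
  qed
  then have "\<forall>\<^sub>F n in sequentially. ereal (1 / real n) * (MAX (i, j)\<in>c \<times> c. S c n \<omega> i j) = - \<infinity>"
    using eventually_gt_at_top[of 0] by (rule eventually_mono[rotated]) auto
  then show ?thesis unfolding growth_def S_def[symmetric] by (rule tendsto_eventually)
qed

lemma component_of_exponent_cases:
  obtains \<rho> where "E_on (component_of i) \<noteq> {}" "AE \<omega> in P. growth (component_of i) \<omega> (ereal \<rho>)"
      "AE \<omega> in P. upper_rate (component_of i) \<rho> \<omega>" "AE \<omega> in P. lower_rate (component_of i) \<rho> \<omega>"
  | "E_on (component_of i) = {}" "AE \<omega> in P. growth (component_of i) \<omega> (- \<infinity>)"
proof (cases "E_on (component_of i) = {}")
  case True
  then show ?thesis using growth_trivial component_of_self that(2) by (metis AE_I2 empty_iff)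
next
  case False
  have ne: "component_of i \<noteq> {}" using component_of_self by blast
  obtain \<rho> where \<rho>: "AE \<omega> in P. upper_rate (component_of i) \<rho> \<omega>" "AE \<omega> in P. lower_rate (component_of i) \<rho> \<omega>"
    using strongly_connected_rate[OF ne component_of_connected[OF False]] by blast
  then have "AE \<omega> in P. growth (component_of i) \<omega> (ereal \<rho>)"
    by eventually_elim (rule growth_rate[OF ne])
  then show ?thesis using that(1) False \<rho> by blast
qed

text \<open>A path from a node of \<open>c\<close>, read backwards in time, either stays in \<open>c\<close> or leaves it at time \<open>s\<close>.\<close>

lemma S_first_exit:
  assumes "i \<in> c"
  shows "(\<exists>k\<in>c. S UNIV n \<omega> i j \<le> S c n \<omega> i k) \<or>
    (\<exists>s t. n = Suc (t + s) \<and> (\<exists>k\<in>c. \<exists>l. l \<notin> c \<and> (k, l) \<in> E \<and>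
      S UNIV n \<omega> i j \<le> S c t ((\<theta> ^^ Suc s) \<omega>) i k + mat ((\<theta> ^^ s) \<omega>) k l + S UNIV s \<omega> l j))"
  using assms
proof (induction n arbitrary: i)
  case 0
  then show ?case by (intro disjI1 bexI[of _ i]) (auto simp: S_0)
next
  case (Suc n)
  have c: "c \<noteq> {}" using Suc.prems by blast
  have S_Suc_ge: "mat ((\<theta> ^^ n) \<omega>) i l + S c n \<omega> l k \<le> S c (Suc n) \<omega> i k" if "l \<in> c" for l n \<omega> k
    unfolding S_Suc[OF c] using that by (intro Max_image_ge) auto
  obtain l where l: "S UNIV (Suc n) \<omega> i j = mat ((\<theta> ^^ n) \<omega>) i l + S UNIV n \<omega> l j"
    unfolding S_Suc[OF UNIV_not_empty]
    using Max_image_attained[of UNIV "\<lambda>k. mat ((\<theta> ^^ n) \<omega>) i k + S UNIV n \<omega> k j"] by auto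
  consider "(i, l) \<notin> E" | "(i, l) \<in> E" "l \<notin> c" | "l \<in> c" by blast
  then show ?case
  proof cases
    case 1
    have "S UNIV (Suc n) \<omega> i j = - \<infinity>"
      using 1 S_neq_PInf[of UNIV n \<omega> l j] unfolding l by (cases "S UNIV n \<omega> l j") (auto simp: mat_def)
    then show ?thesis using Suc.prems by auto
  next
    case 2
    show ?thesis
    proof (rule disjI2, rule exI[of _ n], rule exI[of _ 0], intro conjI bexI[of _ i] exI[of _ l])
      show "S UNIV (Suc n) \<omega> i j
          \<le> S c 0 ((\<theta> ^^ Suc n) \<omega>) i i + mat ((\<theta> ^^ n) \<omega>) i l + S UNIV n \<omega> l j"
        by (simp add: l S_0)
    qed (use 2 Suc.prems in auto)
  next
    case 3
    from Suc.IH[OF 3] show ?thesis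
    proof (elim disjE exE conjE bexE)
      fix k assume k: "k \<in> c" "S UNIV n \<omega> l j \<le> S c n \<omega> l k"
      have "S UNIV (Suc n) \<omega> i j \<le> mat ((\<theta> ^^ n) \<omega>) i l + S c n \<omega> l k"
        unfolding l using k(2) by (intro add_left_mono)
      also have "\<dots> \<le> S c (Suc n) \<omega> i k" by (rule S_Suc_ge[OF 3])
      finally show ?thesis using k(1) by blast
    next
      fix s t k l' assume *: "n = Suc (t + s)" "k \<in> c" "l' \<notin> c" "(k, l') \<in> E"
        "S UNIV n \<omega> l j \<le> S c t ((\<theta> ^^ Suc s) \<omega>) l k + mat ((\<theta> ^^ s) \<omega>) k l' + S UNIV s \<omega> l' j"
      have "S UNIV (Suc n) \<omega> i j \<le> mat ((\<theta> ^^ n) \<omega>) i l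
          + (S c t ((\<theta> ^^ Suc s) \<omega>) l k + mat ((\<theta> ^^ s) \<omega>) k l' + S UNIV s \<omega> l' j)"
        unfolding l using *(5) by (intro add_left_mono)
      also have "\<dots> = (mat ((\<theta> ^^ t) ((\<theta> ^^ Suc s) \<omega>)) i l + S c t ((\<theta> ^^ Suc s) \<omega>) l k)
          + mat ((\<theta> ^^ s) \<omega>) k l' + S UNIV s \<omega> l' j"
        unfolding funpow_shift by (simp only: *(1) add_Suc_right add.assoc)
      also have "\<dots> \<le> S c (Suc t) ((\<theta> ^^ Suc s) \<omega>) i k + mat ((\<theta> ^^ s) \<omega>) k l' + S UNIV s \<omega> l' j"
        by (intro add_right_mono S_Suc_ge[OF 3])
      finally show ?thesis
        using *(1-4) by - (rule disjI2, rule exI[of _ s], rule exI[of _ "Suc t"], auto)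
    qed
  qed
qed

text \<open>Once a walk leaves a component it cannot return, so from the exit node strictly fewer
  nodes are reachable; the induction is on their number. The uniform bound is applied to the window
  of the component, which begins at the variable time \<open>Suc s\<close>.\<close>

lemma S_UNIV_upper:
  assumes rates: "\<And>j. (i, j) \<in> E\<^sup>* \<Longrightarrow> upper_rate (component_of j) q \<omega>"
    and weight: "sublinear (\<lambda>n. weight ((\<theta> ^^ n) \<omega>))" and \<delta>: "\<delta> > 0"
  shows "\<exists>C. \<forall>n j. S UNIV n \<omega> i j \<le> ereal (q * real n + \<delta> * real n + C)"
  using rates \<delta>
proof (induction "card {j. (i, j) \<in> E\<^sup>*}" arbitrary: i \<delta> rule: less_induct)
  case less
  let ?c = "component_of i"
  \<comment> \<open>One third each for the stay in the component, the exit arc and the rest of the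
    walk.\<close>
  define d where "d = \<delta> / 3"
  have d: "d > 0" using less.prems by (simp add: d_def)
  have "upper_rate ?c q \<omega>" using less.prems(1) by blast
  then obtain C1 where C1: "\<And>s n i' j. i' \<in> ?c \<Longrightarrow> j \<in> ?c \<Longrightarrow>
      S ?c n ((\<theta> ^^ s) \<omega>) i' j \<le> ereal (q * real n + d * real (s + n) + C1)"
    using d unfolding upper_rate_def by blast
  obtain C2 where C2: "\<And>n. weight ((\<theta> ^^ n) \<omega>) \<le> d * real n + C2"
    using sublinearD[OF weight d] by blast
  have "\<exists>C. \<forall>n j. S UNIV n \<omega> l j \<le> ereal (q * real n + d * real n + C)"
    if l: "(i, l) \<in> E\<^sup>*" "l \<notin> ?c" for l
  proof (rule less.hyps)
    have "(l, i) \<notin> E\<^sup>*" using l by (simp add: component_of_def)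
    then have "{j. (l, j) \<in> E\<^sup>*} \<subset> {j. (i, j) \<in> E\<^sup>*}" using l(1) by (auto intro: rtrancl_trans)
    then show "card {j. (l, j) \<in> E\<^sup>*} < card {j. (i, j) \<in> E\<^sup>*}" by (intro psubset_card_mono) auto
    show "upper_rate (component_of j) q \<omega>" if "(l, j) \<in> E\<^sup>*" for j
      using less.prems(1) l(1) that by (meson rtrancl_trans)
  qed (rule d)
  then obtain C3 where C3: "\<And>l n j. (i, l) \<in> E\<^sup>* \<Longrightarrow> l \<notin> ?c \<Longrightarrow>
      S UNIV n \<omega> l j \<le> ereal (q * real n + d * real n + C3 l)" by metis
  define C4 where "C4 = (\<Sum>l\<in>UNIV. \<bar>C3 l\<bar>)"
  have C4: "C3 l \<le> C4" for l
    using member_le_sum[of l UNIV "\<lambda>l. \<bar>C3 l\<bar>"] unfolding C4_def by auto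
  have C4_nonneg: "C4 \<ge> 0" unfolding C4_def by (intro sum_nonneg) auto
  \<comment> \<open>The term \<bar>q\<bar> accounts for the time step of the exit arc, which belongs
    to neither \<open>s\<close> nor \<open>t\<close>.\<close>
  define C where "C = \<bar>C1\<bar> + \<bar>C2\<bar> + C4 + \<bar>q\<bar>"
  have "S UNIV n \<omega> i j \<le> ereal (q * real n + \<delta> * real n + C)" for n j
    using S_first_exit[OF component_of_self[of i], where n = n and \<omega> = \<omega> and j = j]
  proof (elim disjE exE conjE bexE)
    fix k assume k: "k \<in> ?c" "S UNIV n \<omega> i j \<le> S ?c n \<omega> i k"
    note k(2)
    also have "S ?c n \<omega> i k \<le> ereal (q * real n + d * real (0 + n) + C1)"
      using C1[OF component_of_self k(1), of n 0] by simp
    also have "\<dots> \<le> ereal (q * real n + \<delta> * real n + C)"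
    proof -
      have "d * real n \<le> \<delta> * real n" using d by (intro mult_right_mono) (auto simp: d_def)
      then show ?thesis using C4_nonneg by (simp add: C_def)
    qed
    finally show ?thesis .
  next
    fix s t k l assume *: "n = Suc (t + s)" "k \<in> ?c" "l \<notin> ?c" "(k, l) \<in> E"
      "S UNIV n \<omega> i j \<le> S ?c t ((\<theta> ^^ Suc s) \<omega>) i k + mat ((\<theta> ^^ s) \<omega>) k l + S UNIV s \<omega> l j"
    have l: "(i, l) \<in> E\<^sup>*" using *(2,4) by (auto simp: component_of_def intro: rtrancl_into_rtrancl)
    note *(5)
    also have "S ?c t ((\<theta> ^^ Suc s) \<omega>) i k + mat ((\<theta> ^^ s) \<omega>) k l + S UNIV s \<omega> l j
      \<le> ereal (q * real t + d * real (Suc s + t) + C1) + ereal (weight ((\<theta> ^^ s) \<omega>))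
        + ereal (q * real s + d * real s + C3 l)"
      by (intro add_mono C1 component_of_self *(2) mat_le_weight C3[OF l *(3)])
    also have "\<dots> \<le> ereal (q * real n + \<delta> * real n + C)"
    proof -
      have "d * real s \<le> d * real n" using d *(1) by (intro mult_left_mono) auto
      moreover have "d * real (Suc s + t) = d * real n" by (simp add: *(1))
      moreover have "q * real n = q * real t + q * real s + q" by (simp add: *(1) algebra_simps)
      moreover have "\<delta> * real n = d * real n + d * real n + d * real n" by (simp add: d_def)
      ultimately have "(q * real t + d * real (Suc s + t) + C1) + weight ((\<theta> ^^ s) \<omega>)
          + (q * real s + d * real s + C3 l) \<le> q * real n + \<delta> * real n + C"
        using C2[of s] C4[of l] unfolding C_def by linarith
      then show ?thesis by simp
    qed
    finally show ?thesis .
  qed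
  then show ?case by blast
qed

text \<open>A fixed walk from \<open>i\<close> to \<open>j\<close> fills the last \<open>k\<close>
  time steps, and the first \<open>n - k\<close> are spent in the component of \<open>j\<close>. The
  fixed walk is weighed at a late point of the orbit, but an integrable function along an orbit is
  sublinear.\<close>

lemma AE_S_UNIV_lower:
  assumes ij: "(i, j) \<in> E\<^sup>*" and lower: "AE \<omega> in P. lower_rate (component_of j) q \<omega>"
  shows "AE \<omega> in P. \<forall>\<delta>>0. \<forall>\<^sub>F n in sequentially. \<exists>l. ereal ((q - \<delta>) * real n) \<le> S UNIV n \<omega> i l"
proof -
  obtain k where "(i, j) \<in> E ^^ k" using ij by (auto simp: rtrancl_power)
  then have k: "(i, j) \<in> E_on UNIV ^^ k" by simp
  have "integrable P (val UNIV k i j)" using k by (intro integrable_val) auto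
  from AE_sublinear_orbit[OF this] lower show ?thesis
  proof eventually_elim
    case (elim \<omega>)
    show ?case
    proof (intro allI impI)
      fix \<delta> :: real assume \<delta>: "\<delta> > 0"
      then have \<delta>3: "\<delta> / 3 > 0" by simp
      obtain D where D: "\<And>n. \<bar>val UNIV k i j ((\<theta> ^^ n) \<omega>)\<bar> \<le> \<delta> / 3 * real n + D"
        using sublinearD[OF elim(1) \<delta>3] by blast
      have "\<forall>\<^sub>F n in sequentially. \<exists>l. ereal ((q - \<delta> / 3) * real n) \<le> S (component_of j) n \<omega> j l"
        using elim(2) \<delta>3 component_of_self[of j] unfolding lower_rate_def
        by (auto elim!: eventually_mono allE[of _ "\<delta> / 3"])
      then obtain n0 where n0: "\<And>n. n \<ge> n0 \<Longrightarrow> \<exists>l. ereal ((q - \<delta> / 3) * real n) \<le> S (component_of j) n \<omega> j l"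
        unfolding eventually_sequentially by blast
      \<comment> \<open>From \<open>n1\<close> on, a third of \<delta> absorbs the constant
        \<open>D\<close> and the growth missed during the \<open>k\<close> steps of the fixed
        walk.\<close>
      obtain n1 :: nat where n1: "(D + \<bar>q - \<delta> / 3\<bar> * real k) / (\<delta> / 3) < real n1"
        using reals_Archimedean2 by blast
      have "\<exists>l. ereal ((q - \<delta>) * real n) \<le> S UNIV n \<omega> i l" if n: "n \<ge> n0 + n1 + k" for n
      proof -
        define m where "m = n - k"
        have m: "n = k + m" "m \<ge> n0" using n by (auto simp: m_def)
        obtain l where l: "ereal ((q - \<delta> / 3) * real m) \<le> S (component_of j) m \<omega> j l" using n0[OF m(2)] by blast
        have "(D + \<bar>q - \<delta> / 3\<bar> * real k) / (\<delta> / 3) \<le> real n" using n1 n by simp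
        then have small: "D + \<bar>q - \<delta> / 3\<bar> * real k \<le> \<delta> / 3 * real n" using \<delta> by (simp add: field_simps)
        have "(q - \<delta> / 3) * real k \<le> \<bar>q - \<delta> / 3\<bar> * real k" by (intro mult_right_mono) auto
        moreover have "(q - \<delta> / 3) * real n = (q - \<delta> / 3) * real k + (q - \<delta> / 3) * real m"
          by (simp only: m of_nat_add distrib_left)
        moreover have "(q - \<delta>) * real n = (q - \<delta> / 3) * real n - \<delta> / 3 * real n - \<delta> / 3 * real n"
          by (simp add: algebra_simps)
        moreover have "\<delta> / 3 * real m \<le> \<delta> / 3 * real n" using \<delta> m by (intro mult_left_mono) auto
        ultimately have "(q - \<delta>) * real n \<le> val UNIV k i j ((\<theta> ^^ m) \<omega>) + (q - \<delta> / 3) * real m"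
          using small D[of m] by linarith
        then have "ereal ((q - \<delta>) * real n)
            \<le> ereal (val UNIV k i j ((\<theta> ^^ m) \<omega>)) + ereal ((q - \<delta> / 3) * real m)" by simp
        also have "\<dots> \<le> S UNIV k ((\<theta> ^^ m) \<omega>) i j + S UNIV m \<omega> j l"
        proof (rule add_mono)
          show "ereal (val UNIV k i j ((\<theta> ^^ m) \<omega>)) \<le> S UNIV k ((\<theta> ^^ m) \<omega>) i j"
            using S_eq_val[of UNIV i j k "(\<theta> ^^ m) \<omega>"] k by simp
          have "S (component_of j) m \<omega> j l \<le> S UNIV m \<omega> j l"
            unfolding S_def using component_of_self by (intro mp_prod_mono_index) auto
          then show "ereal ((q - \<delta> / 3) * real m) \<le> S UNIV m \<omega> j l" using l by (rule order_trans[rotated])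
        qed
        also have "\<dots> \<le> S UNIV n \<omega> i l" unfolding m(1) by (rule S_add_ge) auto
        finally show ?thesis by blast
      qed
      then show "\<forall>\<^sub>F n in sequentially. \<exists>l. ereal ((q - \<delta>) * real n) \<le> S UNIV n \<omega> i l"
        unfolding eventually_sequentially by blast
    qed
  qed
qed

lemma mp_orbit0_eq: "mp_orbit0 (\<lambda>t. mat ((\<theta> ^^ t) \<omega>)) n i = (MAX j. S UNIV n \<omega> i j)"
  by (simp add: mp_orbit0_def mp_apply_def S_def)

text \<open>\<open>L\<close> is known only through the almost sure growth, so the exponents of the
  original matrix can be inserted although this theorem is about \<open>mat\<close>.\<close>

theorem AE_orbit_limit:
  assumes no_line: "\<And>i. \<exists>j. (i, j) \<in> E"
    and exponent: "\<And>j l. (AE \<omega> in P. growth (component_of j) \<omega> l) \<Longrightarrow> L (component_of j) = l"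
  shows "\<exists>\<Gamma>::real. (MAX c\<in>component_of ` {j. (i, j) \<in> E\<^sup>*}. L c) = ereal \<Gamma> \<and>
    (AE \<omega> in P. (\<lambda>n. ereal (1 / real n) * mp_orbit0 (\<lambda>t. mat ((\<theta> ^^ t) \<omega>)) n i) \<longlonglongrightarrow> ereal \<Gamma>)"
proof -
  let ?R = "{j. (i, j) \<in> E\<^sup>*}"
  let ?M = "MAX c\<in>component_of ` ?R. L c"
  have le: "L (component_of j) \<le> ?M" if "j \<in> ?R" for j using that by (intro Max_image_ge) auto
  \<comment> \<open>A reachable component with an arc has a real exponent, so the maximum is real
    even if other components contribute -\<infinity>.\<close>
  obtain j k where jk: "j \<in> ?R" "(j, k) \<in> E" "(k, j) \<in> E\<^sup>*"
    using rtrancl_pigeonhole[OF no_line, of i] by blast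
  then have "(j, k) \<in> E_on (component_of j)" by (auto simp: component_of_def)
  then have "L (component_of j) \<noteq> - \<infinity>"
    using exponent by (cases rule: component_of_exponent_cases[of j]) auto
  then have not_minf: "?M \<noteq> - \<infinity>" using le[OF jk(1)] by auto
  obtain c where "c \<in> component_of ` ?R" "?M = L c"
    using Max_image_attained[of "component_of ` ?R" L] by auto
  then obtain o' where o': "(i, o') \<in> E\<^sup>*" "?M = L (component_of o')" by auto
  obtain \<Gamma> where \<Gamma>: "?M = ereal \<Gamma>" "AE \<omega> in P. lower_rate (component_of o') \<Gamma> \<omega>"
    using component_of_exponent_cases[of o'] exponent not_minf o'(2) by metis
  \<comment> \<open>The rate is raised to the common value \<Gamma>, as the bound for the whole
    orbit uses one rate for all reachable components.\<close>
  have "AE \<omega> in P. upper_rate (component_of j) \<Gamma> \<omega>" if "j \<in> ?R" for j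
  proof (cases rule: component_of_exponent_cases[of j])
    case (1 \<rho>)
    then have "\<rho> \<le> \<Gamma>" using le[OF that] exponent[OF 1(2)] unfolding \<Gamma>(1) by simp
    then show ?thesis using 1(3) by (auto elim: eventually_mono intro: upper_rate_mono)
  next
    case 2
    then show ?thesis using trivial_upper_rate by simp
  qed
  then have "AE \<omega> in P. \<forall>j\<in>?R. upper_rate (component_of j) \<Gamma> \<omega>"
    by (intro AE_ball_countable') (auto intro: countable_finite)
  moreover note AE_sublinear_orbit[OF integrable_weight] AE_S_UNIV_lower[OF o'(1) \<Gamma>(2)]
  ultimately have "AE \<omega> in P.
      (\<lambda>n. ereal (1 / real n) * mp_orbit0 (\<lambda>t. mat ((\<theta> ^^ t) \<omega>)) n i) \<longlonglongrightarrow> ereal \<Gamma>"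
  proof eventually_elim
    case (elim \<omega>)
    have weight: "sublinear (\<lambda>n. weight ((\<theta> ^^ n) \<omega>))" using elim(2) weight_nonneg by simp
    show ?case
      unfolding mp_orbit0_eq
    proof (rule tendsto_rate)
      fix \<delta> :: real assume \<delta>: "\<delta> > 0"
      obtain C where C: "\<And>n j. S UNIV n \<omega> i j \<le> ereal (\<Gamma> * real n + \<delta> * real n + C)"
        using S_UNIV_upper[OF _ weight \<delta>, of i \<Gamma>] elim(1) by blast
      then show "\<exists>C. \<forall>n. (MAX j. S UNIV n \<omega> i j) \<le> ereal (\<Gamma> * real n + \<delta> * real n + C)"
        by (intro exI[of _ C]) auto
      have "\<forall>\<^sub>F n in sequentially. \<exists>l. ereal ((\<Gamma> - \<delta>) * real n) \<le> S UNIV n \<omega> i l"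
        using elim(3) \<delta> by blast
      then show "\<forall>\<^sub>F n in sequentially. ereal ((\<Gamma> - \<delta>) * real n) \<le> (MAX j. S UNIV n \<omega> i j)"
        by eventually_elim (metis Max_image_ge UNIV_I finite order_trans)
    qed
  qed
  then show ?thesis using \<Gamma>(1) by blast
qed

end


section \<open>Return to the random matrix and its graph\<close>

lemma reachable_mp_graph:
  "i \<rightarrow>\<^sup>*\<^bsub>mp_graph P A\<^esub> j \<longleftrightarrow>
     (i, j) \<in> {(i, j). measure P {\<omega>\<in>space P. A \<omega> i j \<noteq> - \<infinity>} > 0}\<^sup>*"
proof -
  have "arcs_ends (mp_graph P A) = {(i, j). measure P {\<omega>\<in>space P. A \<omega> i j \<noteq> - \<infinity>} > 0}"
    by (simp add: arcs_ends_conv mp_graph_def)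
  \<comment> \<open>Library reachability is confined to the vertex set; with all nodes as vertices
    it becomes the plain reflexive transitive closure.\<close>
  moreover have "verts (mp_graph P A) = UNIV" by (simp add: mp_graph_def)
  ultimately show ?thesis
    unfolding reachable_def
    by (auto intro: rtrancl_consistent_rtrancl_on dest: rtrancl_on_rtranclI)
qed

lemma ereal_integrable_real:
  assumes "ereal_integrable P f"
  shows "integrable P (\<lambda>\<omega>. real_of_ereal (f \<omega>))" "AE \<omega> in P. f \<omega> \<noteq> \<infinity> \<and> f \<omega> \<noteq> - \<infinity>"
proof -
  have [measurable]: "f \<in> borel_measurable P" and fin: "(\<integral>\<^sup>+\<omega>. e2ennreal \<bar>f \<omega>\<bar> \<partial>P) < \<infinity>"
    using assms by (auto simp: ereal_integrable_def)
  have "ennreal (norm (real_of_ereal x)) \<le> e2ennreal \<bar>x\<bar>" for x :: ereal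
    by (cases x) (auto simp: ennreal.rep_eq e2ennreal_ereal)
  then have "(\<integral>\<^sup>+\<omega>. ennreal (norm (real_of_ereal (f \<omega>))) \<partial>P) \<le> (\<integral>\<^sup>+\<omega>. e2ennreal \<bar>f \<omega>\<bar> \<partial>P)"
    by (intro nn_integral_mono)
  then show "integrable P (\<lambda>\<omega>. real_of_ereal (f \<omega>))"
    using fin by (intro integrableI_bounded) auto
  have "AE \<omega> in P. e2ennreal \<bar>f \<omega>\<bar> \<noteq> \<infinity>"
    using fin by (intro nn_integral_PInf_AE) auto
  then show "AE \<omega> in P. f \<omega> \<noteq> \<infinity> \<and> f \<omega> \<noteq> - \<infinity>"
    by eventually_elim auto
qed

theorem theorem2p6:
  fixes P :: "'w measure" and \<theta> :: "'w \<Rightarrow> 'w"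
    and A :: "'w \<Rightarrow> 'd::finite \<Rightarrow> 'd \<Rightarrow> ereal"
  defines "x \<equiv> \<lambda>\<omega>. mp_orbit0 (\<lambda>n. A ((\<theta> ^^ n) \<omega>))"
  assumes "prob_space P" and "measure_preserving_map P \<theta>"
    and "random_mp_matrix P A" and "no_line_of_minf P A"
    and "\<And>i j. ereal_integrable P (\<lambda>\<omega>. A \<omega> i j) \<or> (AE \<omega> in P. A \<omega> i j = - \<infinity>)"
    and "\<And>k. k \<in> {1..CARD('d)} \<Longrightarrow> ergodic_map P (\<theta> ^^ k)"
  shows "(AE \<omega> in P. \<forall>i. \<exists>l::real. (\<lambda>n. ereal (1 / real n) * x \<omega> n i) \<longlonglongrightarrow> ereal l) \<and>
    (\<forall>c\<in>mp_components P A. AE \<omega> in P. \<forall>i\<in>c.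
       (\<lambda>n. ereal (1 / real n) * x \<omega> n i) \<longlonglongrightarrow> accessible_exponent P \<theta> A c)"
proof -
  define E where "E = {(i, j). measure P {\<omega>\<in>space P. A \<omega> i j \<noteq> - \<infinity>} > 0}"
  \<comment> \<open>The locale wants integrability for every pair; off the arcs \<open>mat\<close>
    ignores \<open>a\<close>, so 0 serves.\<close>
  define a where "a i j = (if (i, j) \<in> E then (\<lambda>\<omega>. real_of_ereal (A \<omega> i j)) else (\<lambda>_. 0))" for i j
  interpret prob_space P by fact
  have [measurable]: "(\<lambda>\<omega>. A \<omega> i j) \<in> borel_measurable P" for i j
    using assms(4) by (simp add: random_mp_matrix_def)
  have not_arc: "AE \<omega> in P. A \<omega> i j = - \<infinity>" if "(i, j) \<notin> E" for i j
  proof -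
    have "measure P {\<omega>\<in>space P. A \<omega> i j \<noteq> - \<infinity>} = 0"
      using that measure_nonneg[of P "{\<omega>\<in>space P. A \<omega> i j \<noteq> - \<infinity>}"] by (simp add: E_def not_less)
    then show ?thesis by (subst (asm) prob_eq_0) (auto elim!: eventually_mono)
  qed
  have arc: "ereal_integrable P (\<lambda>\<omega>. A \<omega> i j)" if "(i, j) \<in> E" for i j
  proof (rule ccontr)
    assume "\<not> ereal_integrable P (\<lambda>\<omega>. A \<omega> i j)"
    then have "AE \<omega> in P. A \<omega> i j = - \<infinity>" using assms(6) by blast
    then have "AE \<omega> in P. \<omega> \<notin> {\<omega>\<in>space P. A \<omega> i j \<noteq> - \<infinity>}" by eventually_elim simp
    then have "measure P {\<omega>\<in>space P. A \<omega> i j \<noteq> - \<infinity>} = 0" by (subst prob_eq_0) auto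
    then show False using that by (simp add: E_def)
  qed
  interpret mp_system P \<theta> E a
  proof
    show "integrable P (a i j)" for i j
      using ereal_integrable_real(1)[OF arc] by (simp add: a_def)
  qed (use assms(3,7) in auto)
  have entry: "AE \<omega> in P. A \<omega> i j = mat \<omega> i j" for i j
  proof (cases "(i, j) \<in> E")
    case True
    from ereal_integrable_real(2)[OF arc[OF True]] show ?thesis
      by eventually_elim (use True in \<open>auto simp: mat_def a_def ereal_real\<close>)
  next
    case False
    from not_arc[OF this] show ?thesis by eventually_elim (use False in \<open>simp add: mat_def\<close>)
  qed
  have "AE \<omega> in P. \<forall>i j. A \<omega> i j = mat \<omega> i j"
    using entry by (simp add: AE_all_countable)
  then have "AE \<omega> in P. A \<omega> = mat \<omega>" by eventually_elim (intro ext, simp)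
  \<comment> \<open>Invariance of \<open>P\<close> and countability of the times give one null set
    for the whole orbit; outside it all products of \<open>A\<close> and of \<open>mat\<close>
    coincide.\<close>
  then have "AE \<omega> in P. \<forall>n. A ((\<theta> ^^ n) \<omega>) = mat ((\<theta> ^^ n) \<omega>)" by (rule AE_all_funpow)
  then have A_mat: "AE \<omega> in P. (\<lambda>n. A ((\<theta> ^^ n) \<omega>)) = (\<lambda>n. mat ((\<theta> ^^ n) \<omega>))"
    by eventually_elim auto
  have no_line: "\<exists>j. (i, j) \<in> E" for i
  proof (rule ccontr)
    assume "\<nexists>j. (i, j) \<in> E"
    then have "AE \<omega> in P. \<forall>j. A \<omega> i j = - \<infinity>" using not_arc by (simp add: AE_all_countable)
    moreover have "AE \<omega> in P. \<exists>j. A \<omega> i j \<noteq> - \<infinity>"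
      using assms(5) unfolding no_line_of_minf_def by (auto elim: eventually_mono)
    ultimately have "AE \<omega> in P. False" by eventually_elim blast
    then show False by simp
  qed
  have exponent: "component_exponent P \<theta> A (component_of j) = l" if "AE \<omega> in P. growth (component_of j) \<omega> l" for j l
    unfolding component_exponent_def
  proof (rule max_lyapunov_eqI)
    from that A_mat show "AE \<omega> in P. (\<lambda>n. ereal (1 / real n) * (MAX (i, k)\<in>component_of j \<times> component_of j.
        mp_prod (component_of j) (\<lambda>k. A ((\<theta> ^^ k) \<omega>)) n i k)) \<longlonglongrightarrow> l"
      by eventually_elim (simp add: growth_def)
  qed
  have comps: "mp_components P A = range component_of"
  proof (intro set_eqI iffI)
    fix c assume "c \<in> mp_components P A"
    then have c: "c \<noteq> {}" "\<And>u v. u \<in> c \<Longrightarrow> v \<in> c \<Longrightarrow> (u, v) \<in> E\<^sup>*"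
      "\<And>u v. u \<in> c \<Longrightarrow> v \<notin> c \<Longrightarrow> (u, v) \<notin> E\<^sup>* \<or> (v, u) \<notin> E\<^sup>*"
      unfolding pre_digraph.sccs_verts_def reachable_mp_graph E_def[symmetric] by auto
    then obtain i where "i \<in> c" by blast
    then have "c = component_of i" using c(2,3) unfolding component_of_def by blast
    then show "c \<in> range component_of" by blast
  next
    fix c assume "c \<in> range component_of"
    then obtain i where c: "c = component_of i" by blast
    have "c \<noteq> {}" using component_of_self c by blast
    moreover have "(u, v) \<in> E\<^sup>*" if "u \<in> c" "v \<in> c" for u v
      using that rtrancl_trans[of u i E v] by (simp add: c component_of_def)
    moreover have "(u, v) \<notin> E\<^sup>* \<or> (v, u) \<notin> E\<^sup>*" if "u \<in> c" "v \<notin> c" for u v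
      using that rtrancl_trans[of i u E v] rtrancl_trans[of v u E i] by (auto simp: c component_of_def)
    ultimately show "c \<in> mp_components P A"
      unfolding pre_digraph.sccs_verts_def reachable_mp_graph E_def[symmetric] by blast
  qed
  \<comment> \<open>Reachability between components is independent of the chosen nodes, so the
    accessible ones are the components of the nodes reachable from \<open>i\<close>.\<close>
  have accessible: "accessible_components P A (component_of i) = component_of ` {j. (i, j) \<in> E\<^sup>*}" for i
  proof -
    have "component_of i = component_of k \<or> (\<exists>u\<in>component_of i. \<exists>v\<in>component_of k. (u, v) \<in> E\<^sup>*) \<longleftrightarrow> (i, k) \<in> E\<^sup>*" for k
    proof
      assume "component_of i = component_of k \<or> (\<exists>u\<in>component_of i. \<exists>v\<in>component_of k. (u, v) \<in> E\<^sup>*)"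
      then obtain u v where uv: "u \<in> component_of i" "v \<in> component_of k" "(u, v) \<in> E\<^sup>*" using component_of_self by blast
      then have "(i, v) \<in> E\<^sup>*" "(v, k) \<in> E\<^sup>*"
        using rtrancl_trans[of i u E v] by (simp_all add: component_of_def)
      then show "(i, k) \<in> E\<^sup>*" by (rule rtrancl_trans)
    next
      assume "(i, k) \<in> E\<^sup>*"
      then show "component_of i = component_of k \<or> (\<exists>u\<in>component_of i. \<exists>v\<in>component_of k. (u, v) \<in> E\<^sup>*)" using component_of_self by blast
    qed
    then show ?thesis
      unfolding accessible_components_def comps reachable_mp_graph E_def[symmetric] by auto
  qed
  have limit: "\<exists>\<Gamma>::real. accessible_exponent P \<theta> A (component_of i) = ereal \<Gamma> \<and>
      (AE \<omega> in P. (\<lambda>n. ereal (1 / real n) * x \<omega> n i) \<longlonglongrightarrow> ereal \<Gamma>)" for i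
  proof -
    obtain \<Gamma> where \<Gamma>: "accessible_exponent P \<theta> A (component_of i) = ereal \<Gamma>"
      "AE \<omega> in P. (\<lambda>n. ereal (1 / real n) * mp_orbit0 (\<lambda>t. mat ((\<theta> ^^ t) \<omega>)) n i) \<longlonglongrightarrow> ereal \<Gamma>"
      using AE_orbit_limit[of "component_exponent P \<theta> A" i, OF no_line exponent]
      unfolding accessible_exponent_def accessible by blast
    from \<Gamma>(2) A_mat have "AE \<omega> in P. (\<lambda>n. ereal (1 / real n) * x \<omega> n i) \<longlonglongrightarrow> ereal \<Gamma>"
      by eventually_elim (simp add: x_def)
    then show ?thesis using \<Gamma>(1) by blast
  qed
  have component_of_eq: "component_of i = component_of k" if "i \<in> component_of k" for i k
  proof -
    have "(i, k) \<in> E\<^sup>*" "(k, i) \<in> E\<^sup>*" using that by (simp_all add: component_of_def)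
    then have "(i, j) \<in> E\<^sup>* \<longleftrightarrow> (k, j) \<in> E\<^sup>*" "(j, i) \<in> E\<^sup>* \<longleftrightarrow> (j, k) \<in> E\<^sup>*" for j
      using rtrancl_trans[of i k E j] rtrancl_trans[of k i E j] rtrancl_trans[of j i E k]
        rtrancl_trans[of j k E i] by blast+
    then show ?thesis unfolding component_of_def by simp
  qed
  show ?thesis
  proof (intro conjI ballI)
    \<comment> \<open>The limits are fixed node by node before \<omega> is chosen; then the finitely
      many exceptional sets can be united.\<close>
    have "\<forall>i. \<exists>\<Gamma>::real. AE \<omega> in P. (\<lambda>n. ereal (1 / real n) * x \<omega> n i) \<longlonglongrightarrow> ereal \<Gamma>" using limit by blast
    from choice[OF this] obtain \<Gamma> :: "'d \<Rightarrow> real" where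
      "\<forall>i. AE \<omega> in P. (\<lambda>n. ereal (1 / real n) * x \<omega> n i) \<longlonglongrightarrow> ereal (\<Gamma> i)" ..
    then have "AE \<omega> in P. \<forall>i. (\<lambda>n. ereal (1 / real n) * x \<omega> n i) \<longlonglongrightarrow> ereal (\<Gamma> i)"
      by (simp add: AE_all_countable)
    then show "AE \<omega> in P. \<forall>i. \<exists>l::real. (\<lambda>n. ereal (1 / real n) * x \<omega> n i) \<longlonglongrightarrow> ereal l"
      by eventually_elim blast
  next
    fix c assume "c \<in> mp_components P A"
    then obtain k where c: "c = component_of k" using comps by blast
    show "AE \<omega> in P. \<forall>i\<in>c. (\<lambda>n. ereal (1 / real n) * x \<omega> n i) \<longlonglongrightarrow> accessible_exponent P \<theta> A c"
    proof (rule AE_ball_countable')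
      fix i assume "i \<in> c"
      then have "component_of i = c" using component_of_eq c by blast
      then show "AE \<omega> in P. (\<lambda>n. ereal (1 / real n) * x \<omega> n i) \<longlonglongrightarrow> accessible_exponent P \<theta> A c"
        using limit[of i] by auto
    qed (auto intro: countable_finite)
  qed
qed

end
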